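(* For every countably-generated projective diffeological vector space $P$, $D(P)$ is a $k_\omega$-space (hence normal) and a topological vector space, and $D(P\times P)=D(P)\times D(P)$.
   Context: All vector spaces are over $\mathbb{R}$. A diffeological space is a set $X$ with a collection of maps $U\to X$ (called plots), where $U$ ranges over open subsets of $\mathbb{R}^n$, $n\in\mathbb{N}$ arbitrary, such that: every constant map is a plot; the precomposition of a plot $U\to X$ with a smooth map $V\to U$ between open subsets of Euclidean spaces is a plot; a map $U\to X$ that restricts to a plot on each member of some open cover of $U$ is a plot. A map between diffeological spaces is smooth if its composite with every plot of the source is a plot of the target. Open subsets of Euclidean spaces carry the diffeology of all smooth maps. A map into a product is a plot iff its components are plots. The $D$-topology on a diffeological space $X$ is the finest topology for which all plots are continuous; $D(X)$ denotes $X$ with this topology. The equality $D(X\times Y)=D(X)\times D(Y)$ means that the $D$-topology of $X\times Y$ equals the product topology. A diffeological vector space is a vector space with a diffeology such that addition and scalar multiplication are smooth. The free diffeological vector space $F(X)$ on a diffeological space $X$ is the vector space with basis $\{[x]:x\in X\}$, whose plots are the maps locally of the form $u\mapsto\sum_{i=1}^n r_i(u)[q_i(u)]$ with $n\ge 0$, $r_i$ smooth real functions and $q_i$ plots of $X$. The direct sum $\bigoplus_{i\in I}V_i$ of diffeological vector spaces has as plots the maps which locally take values in $\bigoplus_{j\in J}V_j=\prod_{j\in J}V_j$ for some finite $J\subseteq I$ and are plots of this finite product. $W$ is a smooth direct summand of $V$ if there are smooth linear maps $W\to V$ and $V\to W$ whose composite $W\to V\to W$ is the identity. A diffeological vector space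 $P$ is projective if for every linear subduction $V\to W$ (a linear surjection of diffeological vector spaces such that plots of $W$ are exactly the maps locally lifting to plots of $V$) and every smooth linear map $P\to W$ there is a smooth linear map $P\to V$ lifting it. A projective diffeological vector space is countably-generated if it is a smooth direct summand of a countable direct sum of spaces $F(U)$, each $U$ an open subset of some Euclidean space. A $k_\omega$-space is a Hausdorff space $X$ with a countable cover $\{K_n\}_{n\in\mathbb{N}}$ by compact subsets such that $F\subseteq X$ is closed iff $F\cap K_n$ is closed in $K_n$ for every $n$. A topological vector space is a vector space with a topology for which addition (from the product topology) and scalar multiplication are continuous. *)

theory Defs
  imports "HOL-Analysis.Analysis" "HOL-Library.Poly_Mapping"
begin

text \<open>
  Plots have domains in $R^n$ for varying \<open>n\<close>, so \<open>n\<close> has to be a term: $R^n$ is the library's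
  \<^const>\<open>Euclidean_space\<close> \<open>n\<close>, whose points are the sequences vanishing from index \<open>n\<close> on.
  The condition only inspects the values of \<open>f\<close> on \<open>U\<close>, because \<open>U\<close> will be open.
\<close>

primrec Ck_on :: "nat \<Rightarrow> nat \<Rightarrow> (nat \<Rightarrow> real) set \<Rightarrow> ((nat \<Rightarrow> real) \<Rightarrow> real) \<Rightarrow> bool" where
  "Ck_on 0 n U f \<longleftrightarrow> continuous_map (subtopology (Euclidean_space n) U) euclideanreal f"
| "Ck_on (Suc k) n U f \<longleftrightarrow>
     continuous_map (subtopology (Euclidean_space n) U) euclideanreal f \<and>
     (\<forall>i<n. \<exists>g. (\<forall>x\<in>U. ((\<lambda>t. f (x(i := t))) has_real_derivative g x) (at (x i))) \<and>
                Ck_on k n U g)"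

definition smooth_fun :: "nat \<Rightarrow> (nat \<Rightarrow> real) set \<Rightarrow> ((nat \<Rightarrow> real) \<Rightarrow> real) \<Rightarrow> bool" where
  "smooth_fun n U f \<longleftrightarrow> openin (Euclidean_space n) U \<and> (\<forall>k. Ck_on k n U f)"

definition smooth_map ::
    "nat \<Rightarrow> (nat \<Rightarrow> real) set \<Rightarrow> nat \<Rightarrow> (nat \<Rightarrow> real) set \<Rightarrow> ((nat \<Rightarrow> real) \<Rightarrow> (nat \<Rightarrow> real)) \<Rightarrow> bool" where
  "smooth_map m V n U h \<longleftrightarrow>
     openin (Euclidean_space m) V \<and> openin (Euclidean_space n) U \<and> h ` V \<subseteq> U \<and>
     (\<forall>i<n. smooth_fun m V (\<lambda>x. h x i))"

text \<open>
  \<open>plots X n U\<close> consists of the total functions whose restriction to \<open>U\<close> is a plot; values outside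
  \<open>U\<close> are irrelevant, which is the axiom \<open>plot_cong\<close> below.
\<close>

record 'a dspace =
  pts :: "'a set"
  plots :: "nat \<Rightarrow> (nat \<Rightarrow> real) set \<Rightarrow> ((nat \<Rightarrow> real) \<Rightarrow> 'a) set"

locale diffeological_space =
  fixes X :: "'a dspace"
  assumes plot_domain: "p \<in> plots X n U \<Longrightarrow> openin (Euclidean_space n) U"
    and plot_image: "p \<in> plots X n U \<Longrightarrow> p ` U \<subseteq> pts X"
    and plot_cong: "p \<in> plots X n U \<Longrightarrow> (\<And>u. u \<in> U \<Longrightarrow> q u = p u) \<Longrightarrow> q \<in> plots X n U"
    and plot_const: "openin (Euclidean_space n) U \<Longrightarrow> x \<in> pts X \<Longrightarrow> (\<lambda>_. x) \<in> plots X n U"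
    and plot_comp: "p \<in> plots X n U \<Longrightarrow> smooth_map m V n U h \<Longrightarrow> p \<circ> h \<in> plots X m V"
    and plot_local: "openin (Euclidean_space n) U \<Longrightarrow> \<Union>\<V> = U \<Longrightarrow>
       (\<And>V. V \<in> \<V> \<Longrightarrow> openin (Euclidean_space n) V \<and> p \<in> plots X n V) \<Longrightarrow> p \<in> plots X n U"

definition dsmooth :: "'a dspace \<Rightarrow> 'b dspace \<Rightarrow> ('a \<Rightarrow> 'b) \<Rightarrow> bool" where
  "dsmooth X Y f \<longleftrightarrow>
     f ` pts X \<subseteq> pts Y \<and> (\<forall>n U. \<forall>p\<in>plots X n U. f \<circ> p \<in> plots Y n U)"

text \<open>\<open>locally_on n U Q\<close>: every point of \<open>U\<close> has an open neighbourhood \<open>V \<subseteq> U\<close> satisfying \<open>Q\<close>.\<close>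

definition locally_on :: "nat \<Rightarrow> (nat \<Rightarrow> real) set \<Rightarrow> ((nat \<Rightarrow> real) set \<Rightarrow> bool) \<Rightarrow> bool" where
  "locally_on n U Q \<longleftrightarrow>
     (\<forall>u\<in>U. \<exists>V. openin (Euclidean_space n) V \<and> u \<in> V \<and> V \<subseteq> U \<and> Q V)"

definition euclidean_dspace :: "nat \<Rightarrow> (nat \<Rightarrow> real) set \<Rightarrow> (nat \<Rightarrow> real) dspace" where
  "euclidean_dspace n U = \<lparr>pts = U, plots = (\<lambda>m V. {h. smooth_map m V n U h})\<rparr>"

definition real_dspace :: "real dspace" where
  "real_dspace = \<lparr>pts = UNIV, plots = (\<lambda>m V. {r. smooth_fun m V r})\<rparr>"

definition prod_dspace :: "'a dspace \<Rightarrow> 'b dspace \<Rightarrow> ('a \<times> 'b) dspace" where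
  "prod_dspace X Y =
     \<lparr>pts = pts X \<times> pts Y,
      plots = (\<lambda>n U. {p. fst \<circ> p \<in> plots X n U \<and> snd \<circ> p \<in> plots Y n U})\<rparr>"

definition D_topology :: "'a dspace \<Rightarrow> 'a topology" where
  "D_topology X = topology (\<lambda>A. A \<subseteq> pts X \<and>
     (\<forall>n U. \<forall>p\<in>plots X n U. openin (Euclidean_space n) {u\<in>U. p u \<in> A}))"

text \<open>The following lemmas show that this is the finest topology making all plots continuous.\<close>

lemma openin_D_topology:
  assumes "diffeological_space X"
  shows "openin (D_topology X) A \<longleftrightarrow>
     A \<subseteq> pts X \<and> (\<forall>n U. \<forall>p\<in>plots X n U. openin (Euclidean_space n) {u\<in>U. p u \<in> A})"
proof -
  have "istopology (\<lambda>A. A \<subseteq> pts X \<and>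
     (\<forall>n U. \<forall>p\<in>plots X n U. openin (Euclidean_space n) {u\<in>U. p u \<in> A}))"
    unfolding istopology_def
  proof (rule conjI; clarify)
    fix S T assume S: "S \<subseteq> pts X"
      "\<forall>n U. \<forall>p\<in>plots X n U. openin (Euclidean_space n) {u\<in>U. p u \<in> S}"
      and T: "T \<subseteq> pts X"
      "\<forall>n U. \<forall>p\<in>plots X n U. openin (Euclidean_space n) {u\<in>U. p u \<in> T}"
    have eq: "{u\<in>U. p u \<in> S \<inter> T} = {u\<in>U. p u \<in> S} \<inter> {u\<in>U. p u \<in> T}" for U and p :: "_ \<Rightarrow> 'a"
      by auto
    show "S \<inter> T \<subseteq> pts X \<and>
       (\<forall>n U. \<forall>p\<in>plots X n U. openin (Euclidean_space n) {u\<in>U. p u \<in> S \<inter> T})"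
      unfolding eq using S T by (blast intro: openin_Int)
  next
    fix K assume K: "\<forall>S\<in>K. S \<subseteq> pts X \<and>
      (\<forall>n U. \<forall>p\<in>plots X n U. openin (Euclidean_space n) {u\<in>U. p u \<in> S})"
    have eq: "{u\<in>U. p u \<in> \<Union>K} = (\<Union>S\<in>K. {u\<in>U. p u \<in> S})" for U and p :: "_ \<Rightarrow> 'a"
      by auto
    show "\<Union>K \<subseteq> pts X \<and>
       (\<forall>n U. \<forall>p\<in>plots X n U. openin (Euclidean_space n) {u\<in>U. p u \<in> \<Union>K})"
      unfolding eq using K by (blast intro: openin_Union)
  qed
  then show ?thesis
    unfolding D_topology_def by (simp add: topology_inverse')
qed

lemma topspace_D_topology:
  assumes "diffeological_space X"
  shows "topspace (D_topology X) = pts X"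
proof -
  have "{u\<in>U. p u \<in> pts X} = U" if "p \<in> plots X n U" for n U p
    using diffeological_space.plot_image[OF assms that] by auto
  then have "openin (D_topology X) (pts X)"
    using diffeological_space.plot_domain[OF assms] by (auto simp: openin_D_topology[OF assms])
  then show ?thesis
    using openin_D_topology[OF assms] by (meson openin_subset openin_topspace subset_antisym)
qed

lemma continuous_map_D_topology_plot:
  assumes "diffeological_space X" "p \<in> plots X n U"
  shows "continuous_map (subtopology (Euclidean_space n) U) (D_topology X) p"
proof -
  interpret diffeological_space X by fact
  have U: "U \<subseteq> topspace (Euclidean_space n)"
    using plot_domain[OF assms(2)] openin_subset by blast
  show ?thesis
    unfolding continuous_map
  proof (intro conjI allI impI)
    show "p ` topspace (subtopology (Euclidean_space n) U) \<subseteq> topspace (D_topology X)"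
      using plot_image[OF assms(2)] by (auto simp: topspace_D_topology[OF assms(1)])
    fix A assume "openin (D_topology X) A"
    then have "openin (Euclidean_space n) {u\<in>U. p u \<in> A}"
      using assms by (auto simp: openin_D_topology)
    moreover have "{u \<in> topspace (subtopology (Euclidean_space n) U). p u \<in> A} = {u\<in>U. p u \<in> A}"
      using U by auto
    ultimately show "openin (subtopology (Euclidean_space n) U)
        {u \<in> topspace (subtopology (Euclidean_space n) U). p u \<in> A}"
      by (simp add: openin_open_subtopology plot_domain[OF assms(2)])
  qed
qed

lemma D_topology_finest:
  assumes "diffeological_space X" "topspace T = pts X"
    and T: "\<And>n U p. p \<in> plots X n U \<Longrightarrow> continuous_map (subtopology (Euclidean_space n) U) T p"
    and "openin T A"
  shows "openin (D_topology X) A"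
proof -
  interpret diffeological_space X by fact
  have "openin (Euclidean_space n) {u\<in>U. p u \<in> A}" if p: "p \<in> plots X n U" for n U p
  proof -
    have U: "openin (Euclidean_space n) U" "U \<subseteq> topspace (Euclidean_space n)"
      using plot_domain[OF p] openin_subset by blast+
    have "{u \<in> topspace (subtopology (Euclidean_space n) U). p u \<in> A} = {u\<in>U. p u \<in> A}"
      using U by auto
    then show ?thesis
      using openin_continuous_map_preimage[OF T[OF p] \<open>openin T A\<close>] U
      by (simp add: openin_open_subtopology)
  qed
  then show ?thesis
    using assms openin_subset by (fastforce simp: openin_D_topology)
qed

text \<open>The underlying vector space is a linear subspace \<open>pts V\<close> of a type of class \<open>real_vector\<close>.\<close>

locale diffeological_vector_space = diffeological_space V
  for V :: "'a::real_vector dspace" +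
  assumes pts_subspace: "subspace (pts V)"
    and add_smooth: "dsmooth (prod_dspace V V) V (\<lambda>(x, y). x + y)"
    and scaleR_smooth: "dsmooth (prod_dspace real_dspace V) V (\<lambda>(c, x). c *\<^sub>R x)"

definition smooth_linear ::
    "'a::real_vector dspace \<Rightarrow> 'b::real_vector dspace \<Rightarrow> ('a \<Rightarrow> 'b) \<Rightarrow> bool" where
  "smooth_linear V W f \<longleftrightarrow> dsmooth V W f \<and>
     (\<forall>x\<in>pts V. \<forall>y\<in>pts V. f (x + y) = f x + f y) \<and>
     (\<forall>c. \<forall>x\<in>pts V. f (c *\<^sub>R x) = c *\<^sub>R f x)"

text \<open>Finitely supported functions are the elements of free vector spaces and direct sums.\<close>

instantiation poly_mapping :: (type, real_vector) real_vector
begin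

lift_definition scaleR_poly_mapping :: "real \<Rightarrow> ('a \<Rightarrow>\<^sub>0 'b) \<Rightarrow> ('a \<Rightarrow>\<^sub>0 'b)"
  is "\<lambda>c f x. c *\<^sub>R f x"
  by (erule rev_finite_subset) auto

instance
  by standard (transfer, simp add: fun_eq_iff scaleR_add_right scaleR_add_left)+

end

definition free_dvs :: "'a dspace \<Rightarrow> ('a \<Rightarrow>\<^sub>0 real) dspace" where
  "free_dvs X =
     \<lparr>pts = {f. Poly_Mapping.keys f \<subseteq> pts X},
      plots = (\<lambda>n U. {p. openin (Euclidean_space n) U \<and>
        locally_on n U (\<lambda>V. \<exists>(k::nat) r q.
          (\<forall>i<k. smooth_fun n V (r i) \<and> q i \<in> plots X n V) \<and>
          (\<forall>v\<in>V. p v = (\<Sum>i<k. r i v *\<^sub>R Poly_Mapping.single (q i v) 1)))})\<rparr>"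

text \<open>
  For a finite \<open>J\<close>, a map into the finite product of the \<open>V j\<close> with \<open>j \<in> J\<close> is a plot iff its
  components are, and this product is the part of the sum supported in \<open>J\<close>.
\<close>

definition direct_sum_dvs ::
    "'i set \<Rightarrow> ('i \<Rightarrow> 'a::real_vector dspace) \<Rightarrow> ('i \<Rightarrow>\<^sub>0 'a) dspace" where
  "direct_sum_dvs I V =
     \<lparr>pts = {f. Poly_Mapping.keys f \<subseteq> I \<and> (\<forall>i\<in>I. Poly_Mapping.lookup f i \<in> pts (V i))},
      plots = (\<lambda>n U. {p. openin (Euclidean_space n) U \<and>
        locally_on n U (\<lambda>W. \<exists>J. finite J \<and> J \<subseteq> I \<and>
          (\<forall>w\<in>W. Poly_Mapping.keys (p w) \<subseteq> J) \<and>
          (\<forall>j\<in>J. (\<lambda>w. Poly_Mapping.lookup (p w) j) \<in> plots (V j) n W))})\<rparr>"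

definition smooth_direct_summand ::
    "'a::real_vector dspace \<Rightarrow> 'b::real_vector dspace \<Rightarrow> bool" where
  "smooth_direct_summand W V \<longleftrightarrow>
     (\<exists>s r. smooth_linear W V s \<and> smooth_linear V W r \<and> (\<forall>x\<in>pts W. r (s x) = x))"

definition linear_subduction ::
    "'a::real_vector dspace \<Rightarrow> 'b::real_vector dspace \<Rightarrow> ('a \<Rightarrow> 'b) \<Rightarrow> bool" where
  "linear_subduction V W \<pi> \<longleftrightarrow>
     (\<forall>x\<in>pts V. \<forall>y\<in>pts V. \<pi> (x + y) = \<pi> x + \<pi> y) \<and>
     (\<forall>c. \<forall>x\<in>pts V. \<pi> (c *\<^sub>R x) = c *\<^sub>R \<pi> x) \<and>
     \<pi> ` pts V = pts W \<and>
     (\<forall>n U p. p \<in> plots W n U \<longleftrightarrow> openin (Euclidean_space n) U \<and>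
        locally_on n U (\<lambda>N. \<exists>q\<in>plots V n N. \<forall>u\<in>N. \<pi> (q u) = p u))"

text \<open>
  A formula of HOL cannot quantify over types, so the types of the test spaces are parameters
  \<open>'v\<close>, \<open>'w\<close>; the test spaces are all diffeological vector spaces carried by subspaces of these
  types.  A \<open>P\<close> that is projective in the unrestricted sense is so for every choice of \<open>'v\<close> and \<open>'w\<close>.
  Conversely, if \<open>P\<close> embeds in \<open>'w\<close> and the direct sum of the \<open>F(U)\<close> over all plots \<open>U \<rightarrow> P\<close>
  embeds in \<open>'v\<close>, lifting the identity of \<open>P\<close> along the canonical subduction from that sum makes
  \<open>P\<close> a smooth direct summand of it, hence projective in the unrestricted sense.
\<close>

definition projective_dvs ::
    "'v::real_vector itself \<Rightarrow> 'w::real_vector itself \<Rightarrow> 'a::real_vector dspace \<Rightarrow> bool" where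
  "projective_dvs TV TW P \<longleftrightarrow> diffeological_vector_space P \<and>
     (\<forall>(V::'v dspace) (W::'w dspace) \<pi> f.
        diffeological_vector_space V \<and> diffeological_vector_space W \<and>
        linear_subduction V W \<pi> \<and> smooth_linear P W f \<longrightarrow>
        (\<exists>g. smooth_linear P V g \<and> (\<forall>x\<in>pts P. \<pi> (g x) = f x)))"

text \<open>Countable index sets, finite ones included, are represented by subsets of \<open>nat\<close>.\<close>

definition countably_generated_projective ::
    "'v::real_vector itself \<Rightarrow> 'w::real_vector itself \<Rightarrow> 'a::real_vector dspace \<Rightarrow> bool" where
  "countably_generated_projective TV TW P \<longleftrightarrow> projective_dvs TV TW P \<and>
     (\<exists>(I::nat set) d U. (\<forall>i\<in>I. openin (Euclidean_space (d i)) (U i)) \<and>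
        smooth_direct_summand P
          (direct_sum_dvs I (\<lambda>i. free_dvs (euclidean_dspace (d i) (U i)))))"

definition k_omega_space :: "'a topology \<Rightarrow> bool" where
  "k_omega_space X \<longleftrightarrow> Hausdorff_space X \<and>
     (\<exists>K :: nat \<Rightarrow> 'a set. (\<forall>n. compactin X (K n)) \<and> (\<Union>n. K n) = topspace X \<and>
        (\<forall>F. F \<subseteq> topspace X \<longrightarrow>
           (closedin X F \<longleftrightarrow> (\<forall>n. closedin (subtopology X (K n)) (F \<inter> K n)))))"

definition topological_vector_space_on :: "'a::real_vector topology \<Rightarrow> bool" where
  "topological_vector_space_on T \<longleftrightarrow> subspace (topspace T) \<and>
     continuous_map (prod_topology T T) T (\<lambda>(x, y). x + y) \<and>
     continuous_map (prod_topology euclideanreal T) T (\<lambda>(c, x). c *\<^sub>R x)"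

end

theory Submission
  imports Defs
begin

text \<open>
  Let \<open>S\<close> be the direct sum of the \<open>F(U i)\<close>, with \<open>s: P \<rightarrow> S\<close> and \<open>r: S \<rightarrow> P\<close> exhibiting \<open>P\<close> as
  a smooth direct summand. For each finite list \<open>js\<close> of indices, the map sending coefficients \<open>c t\<close>
  and points \<open>x t\<close> of \<open>U (js ! t)\<close> to the sum of the \<open>c t [x t]\<close> is a plot of \<open>S\<close>, and every plot
  of \<open>S\<close> locally factors continuously through one of these countably many charts. Applying this to
  \<open>s \<circ> p\<close> for the plots \<open>p\<close> of \<open>P\<close>, the composites of the charts with \<open>r\<close> are countably many plots
  of \<open>P\<close> that determine the D-topology, and so do the images of countably many compact pieces of
  their domains. The D-topology is Hausdorff because a linear extension to \<open>S\<close> of a continuous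
  function on some \<open>U i\<close>, composed with \<open>s\<close>, is continuous on \<open>D(P)\<close>, and such functions separate
  points. Hence \<open>D(P)\<close> is a \<open>k\<^sub>\<omega>\<close>-space.

  In a product of two \<open>k\<^sub>\<omega>\<close>-spaces, openness can be tested on products of the compact pieces. A set
  whose preimages under products of charts are open is thus open in the product topology. For
  \<open>P \<times> P\<close> this gives \<open>D(P \<times> P) = D(P) \<times> D(P)\<close> and the continuity of addition, for
  \<open>\<real> \<times> P\<close> the continuity of scalar multiplication.
\<close>

section \<open>Exhaustions by compact sets\<close>

text \<open>The compact Hausdorff subspace \<open>K\<close> is normal, and closures taken in it are
  compact again. This keeps an inductive construction supplied with compact sets while relatively
  open sets grow in between.\<close>

lemma compact_Hausdorff_shrink:
  assumes "Hausdorff_space X" "compactin X K" "compactin X C" "C \<subseteq> W"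
    and W: "openin (subtopology X K) W"
  obtains G D where "openin (subtopology X K) G" "C \<subseteq> G" "G \<subseteq> D" "compactin X D" "D \<subseteq> W"
proof -
  let ?S = "subtopology X K"
  have cs: "compact_space ?S"
    using assms(2) by (simp add: compactin_subspace)
  have "Hausdorff_space ?S"
    using assms(1) by (simp add: Hausdorff_space_subtopology)
  with cs have "normal_space ?S"
    using compact_Hausdorff_or_regular_imp_normal_space by blast
  moreover have "C \<subseteq> K"
    using W assms(4) by (meson openin_imp_subset order_trans)
  then have "closedin ?S C"
    using assms(1,3) \<open>Hausdorff_space ?S\<close>
    by (simp add: compactin_imp_closedin compactin_subtopology)
  ultimately obtain G where G: "openin ?S G" "C \<subseteq> G" "?S closure_of G \<subseteq> W"
    using W assms(4) unfolding normal_space_alt by meson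
  have "compactin ?S (?S closure_of G)"
    using cs by (simp add: closedin_compact_space)
  moreover have "G \<subseteq> ?S closure_of G"
    using G(1) by (meson closure_of_subset openin_subset)
  ultimately show ?thesis
    using that G by (metis compactin_subtopology)
qed

text \<open>Compared with \<open>k_omega_space\<close>, the pieces increase and the test is on open
  sets, so that open sets can be built stage by stage.\<close>

locale k_omega_exhaustion =
  fixes T :: "'a topology" and K :: "nat \<Rightarrow> 'a set"
  assumes Hausdorff: "Hausdorff_space T"
    and compact: "compactin T (K n)"
    and mono: "incseq K"
    and cover: "(\<Union>n. K n) = topspace T"
    and determined: "A \<subseteq> topspace T \<Longrightarrow>
      (\<And>n. openin (subtopology T (K n)) (A \<inter> K n)) \<Longrightarrow> openin T A"
begin

lemma K_mono: "m \<le> n \<Longrightarrow> K m \<subseteq> K n"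
  using mono by (simp add: incseq_def)

lemma K_subset: "K n \<subseteq> topspace T"
  using compact compactin_subset_topspace by blast

lemma shift: "k_omega_exhaustion T (\<lambda>n. K (n + m))"
proof
  show "incseq (\<lambda>n. K (n + m))"
    using mono by (simp add: incseq_def)
  have "x \<in> (\<Union>n. K (n + m))" if "x \<in> K n" for x n
    using that K_mono[of n "n + m"] by auto
  then show "(\<Union>n. K (n + m)) = topspace T"
    unfolding cover[symmetric] by (intro subset_antisym subsetI) blast+
  show "openin T A" if "A \<subseteq> topspace T"
    and A: "\<And>n. openin (subtopology T (K (n + m))) (A \<inter> K (n + m))" for A
  proof (rule determined)
    fix n
    obtain W where "openin T W" "A \<inter> K (n + m) = W \<inter> K (n + m)"
      using A[of n] unfolding openin_subtopology by blast
    then show "openin (subtopology T (K n)) (A \<inter> K n)"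
      using K_mono[of n "n + m"] unfolding openin_subtopology by auto
  qed fact
qed (use Hausdorff compact in auto)

lemma k_omega_space: "k_omega_space T"
  unfolding k_omega_space_def
proof (intro conjI exI allI impI iffI)
  fix F n assume "closedin T F"
  then show "closedin (subtopology T (K n)) (F \<inter> K n)"
    by (auto simp: closedin_subtopology)
next
  fix F assume F: "F \<subseteq> topspace T" "\<forall>n. closedin (subtopology T (K n)) (F \<inter> K n)"
  have "openin T (topspace T - F)"
  proof (rule determined)
    fix n
    have "topspace (subtopology T (K n)) - F \<inter> K n = (topspace T - F) \<inter> K n"
      by auto
    then show "openin (subtopology T (K n)) ((topspace T - F) \<inter> K n)"
      using F(2) unfolding closedin_def by metis
  qed auto
  then show "closedin T F"
    using F by (simp add: closedin_def)
qed (use Hausdorff compact cover in auto)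

end

text \<open>\<open>G n\<close> is open only relative to \<open>K (Suc n)\<close>. Because the sets
  \<open>C n\<close> increase, the test on \<open>K n\<close> involves only the \<open>G m\<close>
  with \<open>n \<le> m\<close>, and for these \<open>K n\<close> lies inside
  \<open>K (Suc m)\<close>.\<close>

lemma k_omega_exhaustion_union_open:
  assumes "k_omega_exhaustion T K"
    and G: "\<And>n. openin (subtopology T (K (Suc n))) (G n)"
    and C: "\<And>n. C n \<subseteq> G n" "\<And>n. G n \<subseteq> C (Suc n)" "\<And>n. C n \<subseteq> K n"
  shows "openin T (\<Union>n. C n)"
proof -
  interpret k_omega_exhaustion T K by fact
  have C_mono: "C m \<subseteq> C n" if "m \<le> n" for m n
    using that C(1,2) by (metis lift_Suc_mono_le order_trans)
  show ?thesis
  proof (rule determined)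
    show "(\<Union>n. C n) \<subseteq> topspace T"
      using C(3) K_subset by blast
    fix n
    have "(\<Union>n. C n) \<inter> K n \<subseteq> (\<Union>m\<in>{n..}. G m \<inter> K n)"
    proof
      fix x assume "x \<in> (\<Union>n. C n) \<inter> K n"
      then obtain m where "x \<in> C m" "x \<in> K n" by auto
      then have "x \<in> G (max m n)"
        using C(1) C_mono[of m "max m n"] by auto
      then show "x \<in> (\<Union>m\<in>{n..}. G m \<inter> K n)"
        using \<open>x \<in> K n\<close> by auto
    qed
    with C(2) have eq: "(\<Union>n. C n) \<inter> K n = (\<Union>m\<in>{n..}. G m \<inter> K n)"
      by blast
    have "openin (subtopology T (K n)) (G m \<inter> K n)" if "n \<le> m" for m
    proof -
      obtain W where "openin T W" "G m = W \<inter> K (Suc m)"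
        using G[of m] unfolding openin_subtopology by blast
      then show ?thesis
        using K_mono[of n "Suc m"] that unfolding openin_subtopology by auto
    qed
    then show "openin (subtopology T (K n)) ((\<Union>n. C n) \<inter> K n)"
      unfolding eq by (intro openin_Union) auto
  qed
qed

text \<open>
  The last two assumptions hold for trivial reasons both for points of \<open>K 0\<close> and \<open>L 0\<close> (which
  yields the product theorem) and for \<open>Q\<close> the complement of the diagonal (which yields normality).
\<close>

lemma k_omega_Wallace:
  fixes S :: "'a topology" and T :: "'b topology"
  assumes "k_omega_exhaustion S K" "k_omega_exhaustion T L"
    and A: "closedin S A" and B: "closedin T B" and AB: "A \<times> B \<subseteq> Q"
    and Q: "\<And>n. openin (subtopology (prod_topology S T) (K n \<times> L n)) (Q \<inter> K n \<times> L n)"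
    and OB: "\<And>n x y. x \<in> K n \<Longrightarrow> y \<in> B \<inter> L (Suc n) \<Longrightarrow> y \<in> L n \<or> (x, y) \<in> Q"
    and OA: "\<And>n x y. x \<in> A \<inter> K (Suc n) \<Longrightarrow> y \<in> L n \<Longrightarrow> x \<in> K n \<or> (x, y) \<in> Q"
  obtains U V where "openin S U" "openin T V" "A \<subseteq> U" "B \<subseteq> V" "U \<times> V \<subseteq> Q"
proof -
  interpret S: k_omega_exhaustion S K by fact
  interpret T: k_omega_exhaustion T L by fact
  \<comment> \<open>Stage \<open>n\<close> is a pair of compact sets whose rectangle lies in
    \<open>Q\<close> and which contain the parts of \<open>A\<close> and \<open>B\<close> met so
    far. The unions over all stages will be \<open>U\<close> and \<open>V\<close>.\<close>
  define Inv where "Inv n p \<longleftrightarrow> compactin S (fst p) \<and> compactin T (snd p) \<and> fst p \<subseteq> K n \<and>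
    snd p \<subseteq> L n \<and> A \<inter> K n \<subseteq> fst p \<and> B \<inter> L n \<subseteq> snd p \<and> fst p \<times> snd p \<subseteq> Q"
    for n and p :: "'a set \<times> 'b set"
  \<comment> \<open>The relatively open \<open>G\<close> and \<open>H\<close> between consecutive
    stages are what \<open>k_omega_exhaustion_union_open\<close> asks for.\<close>
  define Step where "Step n p q \<longleftrightarrow> (\<exists>G H. openin (subtopology S (K (Suc n))) G \<and>
    openin (subtopology T (L (Suc n))) H \<and> fst p \<subseteq> G \<and> G \<subseteq> fst q \<and> snd p \<subseteq> H \<and> H \<subseteq> snd q)"
    for n and p q :: "'a set \<times> 'b set"
  have cA: "compactin S (A \<inter> K n)" and cB: "compactin T (B \<inter> L n)" for n
    using S.compact T.compact A B by (auto intro: closed_Int_compactin)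
  have init: "\<exists>p. Inv 0 p"
    by (rule exI[of _ "(A \<inter> K 0, B \<inter> L 0)"]) (use cA cB AB in \<open>auto simp: Inv_def\<close>)
  have step: "\<exists>q. Inv (Suc n) q \<and> Step n p q" if p: "Inv n p" for n p
  proof -
    obtain C D where pCD: "p = (C, D)" by fastforce
    define C' D' where "C' = C \<union> (A \<inter> K (Suc n))" and "D' = D \<union> (B \<inter> L (Suc n))"
    let ?S = "subtopology S (K (Suc n))" and ?T = "subtopology T (L (Suc n))"
    have sub: "C' \<subseteq> K (Suc n)" "D' \<subseteq> L (Suc n)"
      using p S.K_mono[of n "Suc n"] T.K_mono[of n "Suc n"]
      by (auto simp: Inv_def pCD C'_def D'_def)
    have comp: "compactin S C'" "compactin T D'"
      using p cA cB by (auto simp: Inv_def pCD C'_def D'_def intro: compactin_Un)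
    have CD: "C' \<times> D' \<subseteq> Q \<inter> K (Suc n) \<times> L (Suc n)"
    proof (clarify, intro conjI IntI)
      \<comment> \<open>Old times old lies in \<open>Q\<close> by the invariant, new times new by
        \<open>AB\<close>. In the mixed cases \<open>OA\<close> and \<open>OB\<close> either give
        membership in \<open>Q\<close> or put the new point into the old piece, hence into
        \<open>C\<close> or \<open>D\<close>.\<close>
      fix x y assume xy: "x \<in> C'" "y \<in> D'"
      have "C \<subseteq> K n" "D \<subseteq> L n" "A \<inter> K n \<subseteq> C" "B \<inter> L n \<subseteq> D" "C \<times> D \<subseteq> Q"
        using p by (auto simp: Inv_def pCD)
      then show "(x, y) \<in> Q"
        using xy AB OA[of x n y] OB[of x n y] unfolding C'_def D'_def by blast
      show "(x, y) \<in> K (Suc n) \<times> L (Suc n)"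
        using xy sub by blast
    qed
    have "openin (prod_topology ?S ?T) (Q \<inter> K (Suc n) \<times> L (Suc n))"
      using Q[of "Suc n"] by (simp add: subtopology_Times)
    moreover have "compactin ?S C'" "compactin ?T D'"
      using comp sub by (auto simp: compactin_subtopology)
    ultimately obtain G0 H0 where GH: "openin ?S G0" "openin ?T H0" "C' \<subseteq> G0" "D' \<subseteq> H0"
      "G0 \<times> H0 \<subseteq> Q \<inter> K (Suc n) \<times> L (Suc n)"
      using Wallace_theorem_prod_topology CD by metis
    \<comment> \<open>The open rectangle from Wallace's theorem is shrunk in each factor; the
      compact sets \<open>E\<close> and \<open>F\<close> restore the invariant.\<close>
    obtain G E where G: "openin ?S G" "C' \<subseteq> G" "G \<subseteq> E" "compactin S E" "E \<subseteq> G0"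
      using compact_Hausdorff_shrink[OF S.Hausdorff S.compact comp(1) GH(3,1)] by blast
    obtain H F where H: "openin ?T H" "D' \<subseteq> H" "H \<subseteq> F" "compactin T F" "F \<subseteq> H0"
      using compact_Hausdorff_shrink[OF T.Hausdorff T.compact comp(2) GH(4,2)] by blast
    have "G0 \<subseteq> K (Suc n)" "H0 \<subseteq> L (Suc n)"
      using GH(1,2) openin_imp_subset by blast+
    then have "Inv (Suc n) (E, F)"
      using G H GH(5) unfolding Inv_def C'_def D'_def by auto
    moreover have "Step n p (E, F)"
      using G H unfolding Step_def pCD C'_def D'_def by auto
    ultimately show ?thesis by blast
  qed
  obtain f where f: "\<And>n. Inv n (f n)" "\<And>n. Step n (f n) (f (Suc n))"
    using dependent_nat_choice[of Inv Step, OF init step] by blast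
  then obtain G H where GH: "\<And>n. openin (subtopology S (K (Suc n))) (G n) \<and>
      openin (subtopology T (L (Suc n))) (H n) \<and> fst (f n) \<subseteq> G n \<and> G n \<subseteq> fst (f (Suc n)) \<and>
      snd (f n) \<subseteq> H n \<and> H n \<subseteq> snd (f (Suc n))"
    unfolding Step_def by metis
  let ?U = "\<Union>n. fst (f n)" and ?V = "\<Union>n. snd (f n)"
  have fmono: "fst (f m) \<subseteq> fst (f n)" "snd (f m) \<subseteq> snd (f n)" if "m \<le> n" for m n
    using that GH lift_Suc_mono_le[of "\<lambda>n. fst (f n)" m n] lift_Suc_mono_le[of "\<lambda>n. snd (f n)" m n]
    by blast+
  show ?thesis
  proof
    show "openin S ?U"
    proof (rule k_omega_exhaustion_union_open[OF assms(1)])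
      show "openin (subtopology S (K (Suc n))) (G n)" "fst (f n) \<subseteq> G n" "G n \<subseteq> fst (f (Suc n))" for n
        using GH[of n] by blast+
      show "fst (f n) \<subseteq> K n" for n
        using f(1)[of n] by (simp add: Inv_def)
    qed
    show "openin T ?V"
    proof (rule k_omega_exhaustion_union_open[OF assms(2)])
      show "openin (subtopology T (L (Suc n))) (H n)" "snd (f n) \<subseteq> H n" "H n \<subseteq> snd (f (Suc n))" for n
        using GH[of n] by blast+
      show "snd (f n) \<subseteq> L n" for n
        using f(1)[of n] by (simp add: Inv_def)
    qed
    show "A \<subseteq> ?U"
    proof
      fix x assume "x \<in> A"
      moreover from this obtain n where "x \<in> K n"
        using S.cover closedin_subset[OF A] by blast
      ultimately show "x \<in> ?U" using f(1)[of n] by (auto simp: Inv_def)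
    qed
    show "B \<subseteq> ?V"
    proof
      fix x assume "x \<in> B"
      moreover from this obtain n where "x \<in> L n"
        using T.cover closedin_subset[OF B] by blast
      ultimately show "x \<in> ?V" using f(1)[of n] by (auto simp: Inv_def)
    qed
    show "?U \<times> ?V \<subseteq> Q"
    proof clarify
      fix x y m n assume "x \<in> fst (f m)" "y \<in> snd (f n)"
      then have "(x, y) \<in> fst (f (max m n)) \<times> snd (f (max m n))"
        using fmono[of m "max m n"] fmono[of n "max m n"] by auto
      then show "(x, y) \<in> Q" using f(1)[of "max m n"] unfolding Inv_def by blast
    qed
  qed
qed

text \<open>A rectangle that avoids the diagonal is a pair of disjoint sets. The diagonal is closed
  by the Hausdorff property, so separating \<open>A\<close> from \<open>B\<close> amounts to finding
  an open rectangle in the open set \<open>Q\<close>.\<close>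

lemma k_omega_exhaustion_normal:
  assumes "k_omega_exhaustion T K"
  shows "normal_space T"
  unfolding normal_space_def
proof (intro allI impI)
  interpret k_omega_exhaustion T K by fact
  fix A B assume AB: "closedin T A \<and> closedin T B \<and> disjnt A B"
  define Q where "Q = topspace T \<times> topspace T - (\<lambda>x. (x, x)) ` topspace T"
  have Q: "openin (prod_topology T T) Q"
    using Hausdorff unfolding Hausdorff_space_closedin_diagonal Q_def closedin_def by simp
  obtain U V where "openin T U" "openin T V" "A \<subseteq> U" "B \<subseteq> V" "U \<times> V \<subseteq> Q"
  proof (rule k_omega_Wallace[OF assms assms, of A B Q])
    show "A \<times> B \<subseteq> Q"
      using AB closedin_subset unfolding Q_def by (fastforce simp: disjnt_iff)
    show "openin (subtopology (prod_topology T T) (K n \<times> K n)) (Q \<inter> K n \<times> K n)" for n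
      using Q by (auto simp: openin_subtopology)
    \<comment> \<open>If \<open>y\<close> lies outside \<open>K n\<close>, it differs from the point
      \<open>x\<close> of \<open>K n\<close>, so the pair is off the diagonal.\<close>
    show "y \<in> K n \<or> (x, y) \<in> Q" if "x \<in> K n" "y \<in> B \<inter> K (Suc n)" for x y n
      using that K_subset unfolding Q_def by blast
    show "x \<in> K n \<or> (x, y) \<in> Q" if "x \<in> A \<inter> K (Suc n)" "y \<in> K n" for x y n
      using that K_subset unfolding Q_def by blast
  qed (use AB in auto)
  moreover from this have "disjnt U V"
    unfolding Q_def disjnt_def using openin_subset[of T U] by auto
  ultimately show "\<exists>U V. openin T U \<and> openin T V \<and> A \<subseteq> U \<and> B \<subseteq> V \<and> disjnt U V"
    by blast
qed

text \<open>Each point of \<open>Q\<close> gets a rectangle from \<open>k_omega_Wallace\<close>,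
  applied to singletons. The two exhaustions are shifted separately until the coordinates lie in the
  initial pieces, which is why \<open>O\<close> pairs independent \<open>m\<close> and
  \<open>n\<close>.\<close>

lemma k_omega_exhaustion_prod_openin:
  assumes "k_omega_exhaustion S K" "k_omega_exhaustion T L"
    and Q: "Q \<subseteq> topspace S \<times> topspace T"
    and O: "\<And>m n. openin (subtopology (prod_topology S T) (K m \<times> L n)) (Q \<inter> K m \<times> L n)"
  shows "openin (prod_topology S T) Q"
  unfolding openin_prod_topology_alt
proof (intro allI impI)
  interpret S: k_omega_exhaustion S K by fact
  interpret T: k_omega_exhaustion T L by fact
  fix x y assume xy: "(x, y) \<in> Q"
  then obtain m n where mn: "x \<in> K m" "y \<in> L n"
    using Q S.cover T.cover by blast
  obtain U V where "openin S U" "openin T V" "{x} \<subseteq> U" "{y} \<subseteq> V" "U \<times> V \<subseteq> Q"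
  proof (rule k_omega_Wallace[OF S.shift[of m] T.shift[of n], of "{x}" "{y}" Q])
    show "closedin S {x}"
      using S.Hausdorff mn S.K_subset by (metis Hausdorff_imp_t1_space closedin_t1_singleton subsetD)
    show "closedin T {y}"
      using T.Hausdorff mn T.K_subset by (metis Hausdorff_imp_t1_space closedin_t1_singleton subsetD)
    show "y' \<in> L (k + n) \<or> (x', y') \<in> Q" if "x' \<in> K (k + m)" "y' \<in> {y} \<inter> L (Suc k + n)" for x' y' k
      using that mn T.K_mono[of n "k + n"] by auto
    show "x' \<in> K (k + m) \<or> (x', y') \<in> Q" if "x' \<in> {x} \<inter> K (Suc k + m)" "y' \<in> L (k + n)" for x' y' k
      using that mn S.K_mono[of m "k + m"] by auto
  qed (use xy O in auto)
  then show "\<exists>U V. openin S U \<and> openin T V \<and> x \<in> U \<and> y \<in> V \<and> U \<times> V \<subseteq> Q"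
    by blast
qed

section \<open>Countable compact covers\<close>

text \<open>The form in which an atlas supplies compact sets: a countable family without an order.
  Finite unions along an enumeration turn it into an exhaustion.\<close>

locale k_omega_cover =
  fixes T :: "'a topology" and \<C> :: "'a set set"
  assumes Hausdorff: "Hausdorff_space T"
    and countable: "countable \<C>"
    and compact: "C \<in> \<C> \<Longrightarrow> compactin T C"
    and cover: "\<Union>\<C> = topspace T"
    and determined: "A \<subseteq> topspace T \<Longrightarrow>
      (\<And>C. C \<in> \<C> \<Longrightarrow> openin (subtopology T C) (A \<inter> C)) \<Longrightarrow> openin T A"
begin

text \<open>Inserting \<open>{}\<close> keeps the enumeration meaningful when \<open>\<C>\<close> is
  empty, as it can be for an empty space.\<close>

definition piece :: "nat \<Rightarrow> 'a set" where
  "piece = from_nat_into (insert {} \<C>)"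

definition stage :: "nat \<Rightarrow> 'a set" where
  "stage n = (\<Union>i\<le>n. piece i)"

lemma piece_cases: "piece i = {} \<or> piece i \<in> \<C>"
  unfolding piece_def using from_nat_into[of "insert {} \<C>" i] by blast

lemma piece_compact: "compactin T (piece i)"
  using piece_cases[of i] compact by auto

lemma piece_surj:
  assumes "C \<in> \<C>"
  obtains i where "piece i = C"
  unfolding piece_def using assms countable from_nat_into_surj[of "insert {} \<C>" C] by auto

lemma exhaustion: "k_omega_exhaustion T stage"
proof
  show "Hausdorff_space T" by (rule Hausdorff)
  show "compactin T (stage n)" for n
    unfolding stage_def by (intro compactin_Union) (auto simp: piece_compact)
  show "incseq stage"
    unfolding incseq_def stage_def by (meson UN_mono atMost_subset_iff order_refl)
  have "C \<subseteq> (\<Union>n. stage n)" if "C \<in> \<C>" for C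
  proof -
    obtain i where "piece i = C" using \<open>C \<in> \<C>\<close> by (rule piece_surj)
    then have "C \<subseteq> stage i" unfolding stage_def by auto
    then show ?thesis by auto
  qed
  then have "topspace T \<subseteq> (\<Union>n. stage n)"
    unfolding cover[symmetric] by (rule Union_least)
  moreover have "stage n \<subseteq> topspace T" for n
    unfolding stage_def using piece_compact compactin_subset_topspace by blast
  ultimately show "(\<Union>n. stage n) = topspace T"
    by (intro subset_antisym UN_least)
  show "openin T A" if A: "A \<subseteq> topspace T"
    and O: "\<And>n. openin (subtopology T (stage n)) (A \<inter> stage n)" for A
  proof (rule determined[OF A])
    fix C assume "C \<in> \<C>"
    then obtain i where "piece i = C" by (rule piece_surj)
    then have "C \<subseteq> stage i" unfolding stage_def by auto
    moreover obtain W where "openin T W" "A \<inter> stage i = W \<inter> stage i"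
      using O[of i] unfolding openin_subtopology by blast
    ultimately show "openin (subtopology T C) (A \<inter> C)"
      unfolding openin_subtopology by blast
  qed
qed

end

text \<open>Relative openness does not pass directly from single rectangles to finite unions, but
  closedness does. The rectangles are closed, so their parts outside \<open>Q\<close> are closed in
  the product, and finitely many of these make up the part of a stage rectangle outside
  \<open>Q\<close>.\<close>

lemma k_omega_cover_prod_openin:
  assumes "k_omega_cover S \<C>" "k_omega_cover T \<D>"
    and Q: "Q \<subseteq> topspace S \<times> topspace T"
    and open_pieces: "\<And>C D. C \<in> \<C> \<Longrightarrow> D \<in> \<D> \<Longrightarrow>
      openin (subtopology (prod_topology S T) (C \<times> D)) (Q \<inter> C \<times> D)"
  shows "openin (prod_topology S T) Q"
proof -
  interpret S: k_omega_cover S \<C> by fact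
  interpret T: k_omega_cover T \<D> by fact
  let ?P = "prod_topology S T"
  show ?thesis
  proof (rule k_omega_exhaustion_prod_openin[OF S.exhaustion T.exhaustion Q])
    fix m n
    have closed: "closedin ?P (S.piece i \<times> T.piece j - Q)" for i j
    proof (cases "S.piece i = {} \<or> T.piece j = {}")
      case False
      let ?R = "S.piece i \<times> T.piece j"
      have R: "closedin ?P ?R"
        using S.piece_compact T.piece_compact S.Hausdorff T.Hausdorff
        by (simp add: closedin_prod_Times_iff compactin_imp_closedin)
      have "openin (subtopology ?P ?R) (Q \<inter> ?R)"
        using False S.piece_cases T.piece_cases open_pieces by blast
      then have "closedin (subtopology ?P ?R) (topspace (subtopology ?P ?R) - Q \<inter> ?R)"
        by (rule closedin_diff[OF closedin_topspace])
      moreover have "topspace (subtopology ?P ?R) - Q \<inter> ?R = ?R - Q"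
        using closedin_subset[OF R] by auto
      ultimately show ?thesis
        using R closedin_trans_full by metis
    qed auto
    have eq: "S.stage m \<times> T.stage n - Q =
        \<Union>((\<lambda>(i, j). S.piece i \<times> T.piece j - Q) ` ({..m} \<times> {..n}))"
      unfolding S.stage_def T.stage_def by auto
    have "closedin ?P (S.stage m \<times> T.stage n - Q)"
      unfolding eq by (rule closedin_Union) (use closed in auto)
    then have "openin ?P (topspace ?P - (S.stage m \<times> T.stage n - Q))"
      by (rule openin_diff[OF openin_topspace])
    moreover have "Q \<inter> S.stage m \<times> T.stage n =
        (topspace ?P - (S.stage m \<times> T.stage n - Q)) \<inter> S.stage m \<times> T.stage n"
      using Q by auto
    ultimately show "openin (subtopology ?P (S.stage m \<times> T.stage n)) (Q \<inter> S.stage m \<times> T.stage n)"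
      unfolding openin_subtopology by blast
  qed
qed

text \<open>The part of \<open>C \<times> D\<close> sent outside \<open>Q\<close> is compact, so its
  image is closed in the Hausdorff product. Lying in that part depends only on the image pair, so
  the complement of the image cuts out \<open>Q\<close> on the image rectangle.\<close>

lemma compact_images_prod_openin:
  assumes f: "continuous_map (subtopology X V) S f" and g: "continuous_map (subtopology Y W) T g"
    and "Hausdorff_space S" "Hausdorff_space T"
    and C: "compactin X C" "C \<subseteq> V" and D: "compactin Y D" "D \<subseteq> W"
    and Q: "openin (subtopology (prod_topology X Y) (V \<times> W)) {(x, y) \<in> V \<times> W. (f x, g y) \<in> Q}"
  shows "openin (subtopology (prod_topology S T) (f ` C \<times> g ` D)) (Q \<inter> f ` C \<times> g ` D)"
proof -
  let ?XY = "prod_topology X Y" and ?ST = "prod_topology S T"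
  let ?N = "{(x, y) \<in> C \<times> D. (f x, g y) \<notin> Q}" and ?h = "\<lambda>(x, y). (f x, g y)"
  obtain G where G: "openin ?XY G" "{(x, y) \<in> V \<times> W. (f x, g y) \<in> Q} = G \<inter> V \<times> W"
    using Q unfolding openin_subtopology by blast
  have CD: "C \<subseteq> topspace X" "D \<subseteq> topspace Y"
    using C D compactin_subset_topspace by blast+
  have "?N = (C \<times> D) \<inter> (topspace ?XY - G)"
    using G(2) C D CD by auto
  moreover have "closedin ?XY (topspace ?XY - G)"
    using G(1) by (rule closedin_diff[OF closedin_topspace])
  ultimately have "compactin ?XY ?N"
    using C D by (metis compact_Int_closedin compactin_Times)
  then have N: "compactin (prod_topology (subtopology X V) (subtopology Y W)) ?N"
    using C D by (auto simp: compactin_subtopology simp flip: subtopology_Times)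
  have "continuous_map (prod_topology (subtopology X V) (subtopology Y W)) ?ST ?h"
    using f g by (simp add: continuous_map_prod_top)
  then have "compactin ?ST (?h ` ?N)"
    using N image_compactin by blast
  then have "closedin ?ST (?h ` ?N)"
    using assms(3,4) by (simp add: Hausdorff_space_prod_topology compactin_imp_closedin)
  then have "openin ?ST (topspace ?ST - ?h ` ?N)"
    by (rule openin_diff[OF openin_topspace])
  moreover have "f ` C \<times> g ` D \<subseteq> topspace ?ST"
  proof -
    have "C \<subseteq> topspace X \<inter> V" "D \<subseteq> topspace Y \<inter> W"
      using CD C D by auto
    then have "f ` C \<subseteq> topspace S" "g ` D \<subseteq> topspace T"
      using continuous_map_image_subset_topspace[OF f] continuous_map_image_subset_topspace[OF g]
      by (simp_all, (meson image_mono order_trans)+)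
    then show ?thesis by auto
  qed
  then have "Q \<inter> f ` C \<times> g ` D = (topspace ?ST - ?h ` ?N) \<inter> f ` C \<times> g ` D"
    by (auto simp: image_iff)
  ultimately show ?thesis
    unfolding openin_subtopology by blast
qed

section \<open>Countably many compact pieces of an open Euclidean set\<close>

lemma second_countable_Euclidean_space: "second_countable (Euclidean_space n)"
proof -
  obtain B :: "(nat \<Rightarrow> real) set set" where "countable B" "topological_basis B"
    using ex_countable_basis by blast
  then have "second_countable (euclidean :: (nat \<Rightarrow> real) topology)"
    unfolding second_countable_def by (metis open_openin topological_basisE topological_basis_open)
  then show ?thesis
    unfolding Euclidean_space_def euclidean_product_topology by (rule second_countable_subtopology)
qed

text \<open>Local compactness gives every point a compact neighbourhood inside \<open>V\<close>, and
  the Lindelof property selects countably many. Their interiors cover \<open>V\<close>, so openness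
  in \<open>V\<close> can be tested piece by piece.\<close>

lemma open_compact_pieces:
  assumes V: "openin (Euclidean_space n) V"
  obtains \<K> where "countable \<K>" "\<And>C. C \<in> \<K> \<Longrightarrow> compactin (Euclidean_space n) C \<and> C \<subseteq> V"
    "\<And>x. x \<in> V \<Longrightarrow> \<exists>C\<in>\<K>. \<exists>W. openin (Euclidean_space n) W \<and> x \<in> W \<and> W \<subseteq> C"
proof -
  let ?E = "Euclidean_space n"
  have "neighbourhood_base_of (compactin ?E) ?E"
    using locally_compact_Euclidean_space Hausdorff_Euclidean_space
      locally_compact_space_neighbourhood_base by blast
  then have "\<forall>x\<in>V. \<exists>W C. openin ?E W \<and> compactin ?E C \<and> x \<in> W \<and> W \<subseteq> C \<and> C \<subseteq> V"
    using V unfolding neighbourhood_base_of by meson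
  then obtain W C where WC: "\<And>x. x \<in> V \<Longrightarrow>
      openin ?E (W x) \<and> compactin ?E (C x) \<and> x \<in> W x \<and> W x \<subseteq> C x \<and> C x \<subseteq> V"
    by metis
  have "Lindelof_space (subtopology ?E V)"
    by (intro second_countable_imp_Lindelof_space second_countable_subtopology
        second_countable_Euclidean_space)
  moreover have "openin (subtopology ?E V) U" if "U \<in> W ` V" for U
  proof -
    have "openin ?E U" "U \<subseteq> V" using that WC by blast+
    then show ?thesis using V openin_open_subtopology by blast
  qed
  moreover have "\<Union>(W ` V) = V"
  proof (intro subset_antisym UN_least subsetI)
    show "y \<in> V" if "x \<in> V" "y \<in> W x" for x y using WC[OF that(1)] that(2) by blast
    show "x \<in> \<Union>(W ` V)" if "x \<in> V" for x using WC[OF that] that by blast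
  qed
  then have "\<Union>(W ` V) = topspace (subtopology ?E V)"
    using openin_subset[OF V] by (simp add: Int_absorb1)
  ultimately obtain \<V> where \<V>: "countable \<V>" "\<V> \<subseteq> W ` V" "\<Union>\<V> = topspace (subtopology ?E V)"
    using Lindelof_spaceD by meson
  then obtain X where X: "countable X" "X \<subseteq> V" "\<V> = W ` X"
    by (meson countable_subset_image)
  show ?thesis
  proof
    show "countable (C ` X)"
      using X by simp
    show "compactin ?E D \<and> D \<subseteq> V" if "D \<in> C ` X" for D
      using that X WC by blast
    show "\<exists>D\<in>C ` X. \<exists>U. openin ?E U \<and> x \<in> U \<and> U \<subseteq> D" if "x \<in> V" for x
    proof -
      have "x \<in> \<Union>\<V>" using that \<V>(3) openin_subset[OF V] by auto
      then show ?thesis using X WC by blast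
    qed
  qed
qed

section \<open>Charts of a direct sum of free spaces\<close>

lemma continuous_map_Euclidean_coordinate:
  "continuous_map (Euclidean_space n) euclideanreal (\<lambda>x. x i)"
  unfolding Euclidean_space_def
  by (intro continuous_map_from_subtopology continuous_map_product_coordinates) simp

lemma continuous_map_coordinate:
  "continuous_map (subtopology (Euclidean_space n) V) euclideanreal (\<lambda>x. x i)"
  by (intro continuous_map_from_subtopology continuous_map_Euclidean_coordinate)

lemma Ck_on_const: "Ck_on k n U (\<lambda>_. c)"
proof (induction k arbitrary: c)
  case (Suc k)
  then show ?case by (auto intro!: exI[of _ "\<lambda>_. 0"])
qed simp

lemma Ck_on_coordinate: "Ck_on k n U (\<lambda>x. x i)"
proof (cases k)
  case (Suc k)
  have "\<exists>g. (\<forall>x\<in>U. ((\<lambda>t. (x(j := t)) i) has_real_derivative g x) (at (x j))) \<and> Ck_on k n U g" for j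
    by (rule exI[of _ "\<lambda>_. if i = j then 1 else 0"]) (auto simp: Ck_on_const)
  then show ?thesis
    using Suc by (simp add: continuous_map_coordinate)
qed (simp add: continuous_map_coordinate)

lemma smooth_fun_coordinate: "openin (Euclidean_space n) U \<Longrightarrow> smooth_fun n U (\<lambda>x. x i)"
  by (simp add: smooth_fun_def Ck_on_coordinate)

lemma smooth_fun_continuous:
  "smooth_fun n U f \<Longrightarrow> continuous_map (subtopology (Euclidean_space n) U) euclideanreal f"
  unfolding smooth_fun_def by (metis Ck_on.simps(1))

lemma smooth_map_continuous_coordinate:
  assumes "smooth_map m V n U h"
  shows "continuous_map (subtopology (Euclidean_space m) V) euclideanreal (\<lambda>x. h x i)"
proof (cases "i < n")
  case True
  then show ?thesis using assms smooth_fun_continuous by (simp add: smooth_map_def)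
next
  \<comment> \<open>\<open>smooth_map\<close> does not speak of indices from \<open>n\<close> on;
    there the coordinate vanishes because \<open>h\<close> takes values in
    \<open>Euclidean_space n\<close>.\<close>
  case False
  have "h x i = 0" if "x \<in> V" for x
  proof -
    have "h x \<in> topspace (Euclidean_space n)"
      using that assms openin_subset unfolding smooth_map_def by blast
    then show ?thesis using False by (simp add: topspace_Euclidean_space)
  qed
  then show ?thesis
    by (intro continuous_map_eq[of _ _ "\<lambda>_. 0" "\<lambda>x. h x i"]) auto
qed

text \<open>The truncation at \<open>d\<close> lands in \<open>Euclidean_space d\<close>;
  \<open>block_point\<close>, \<open>left_part\<close> and \<open>right_part\<close> all have this
  shape.\<close>

lemma openin_Euclidean_preimage:
  assumes "\<And>c. c < d \<Longrightarrow> continuous_map (Euclidean_space n) euclideanreal (\<lambda>x. f x c)"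
    and "openin (Euclidean_space d) U"
  shows "openin (Euclidean_space n)
    {x \<in> topspace (Euclidean_space n). (\<lambda>c. if c < d then f x c else 0) \<in> U}"
  using assms by (intro openin_continuous_map_preimage[of _ "Euclidean_space d"])
    (auto simp: continuous_map_componentwise_Euclidean_space)

lemma locally_onI: "openin (Euclidean_space n) U \<Longrightarrow> Q U \<Longrightarrow> locally_on n U Q"
  unfolding locally_on_def by blast

lemma locally_onD:
  "locally_on n U Q \<Longrightarrow> u \<in> U \<Longrightarrow> \<exists>V. openin (Euclidean_space n) V \<and> u \<in> V \<and> V \<subseteq> U \<and> Q V"
  unfolding locally_on_def by blast

lemma openin_locally:
  assumes "\<And>x. x \<in> A \<Longrightarrow> \<exists>V. openin X V \<and> x \<in> V \<and> openin X (V \<inter> A)"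
  shows "openin X A"
  using assms by (subst openin_subopen) blast

text \<open>
  A point of \<open>Euclidean_space (length js * D)\<close> is read as \<open>length js\<close> blocks of \<open>D\<close> coordinates;
  the block of \<open>t\<close> holds the coefficient and the basis point of a summand with index \<open>js ! t\<close>.
\<close>

definition block_coef :: "nat \<Rightarrow> nat \<Rightarrow> (nat \<Rightarrow> real) \<Rightarrow> real" where
  "block_coef D t x = x (t * D)"

text \<open>Slot 0 of a block holds the coefficient, hence the shift by \<open>Suc\<close>. Padding
  with 0 puts the point into \<open>Euclidean_space d\<close>.\<close>

definition block_point :: "nat \<Rightarrow> nat \<Rightarrow> nat \<Rightarrow> (nat \<Rightarrow> real) \<Rightarrow> (nat \<Rightarrow> real)" where
  "block_point D d t x = (\<lambda>c. if c < d then x (t * D + Suc c) else 0)"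

text \<open>A common block length above every \<open>d (js ! t)\<close> lets \<open>div\<close> and
  \<open>mod\<close> decode positions. The sum is a convenient bound; \<open>chart\<close> ignores
  the surplus slots.\<close>

definition block_size :: "(nat \<Rightarrow> nat) \<Rightarrow> nat list \<Rightarrow> nat" where
  "block_size d js = Suc (sum_list (map d js))"

definition chart_dim :: "(nat \<Rightarrow> nat) \<Rightarrow> nat list \<Rightarrow> nat" where
  "chart_dim d js = length js * block_size d js"

definition chart_dom :: "(nat \<Rightarrow> nat) \<Rightarrow> (nat \<Rightarrow> (nat \<Rightarrow> real) set) \<Rightarrow> nat list \<Rightarrow> (nat \<Rightarrow> real) set" where
  "chart_dom d U js = {x \<in> topspace (Euclidean_space (chart_dim d js)).
     \<forall>t<length js. block_point (block_size d js) (d (js ! t)) t x \<in> U (js ! t)}"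

text \<open>The sum runs over positions, so an index that recurs in \<open>js\<close> contributes
  several terms to the same free summand.\<close>

definition chart :: "(nat \<Rightarrow> nat) \<Rightarrow> nat list \<Rightarrow> (nat \<Rightarrow> real) \<Rightarrow> (nat \<Rightarrow>\<^sub>0 ((nat \<Rightarrow> real) \<Rightarrow>\<^sub>0 real))" where
  "chart d js x = (\<Sum>t<length js. Poly_Mapping.single (js ! t)
     (block_coef (block_size d js) t x *\<^sub>R
      Poly_Mapping.single (block_point (block_size d js) (d (js ! t)) t x) 1))"

abbreviation sum_of_free :: "nat set \<Rightarrow> (nat \<Rightarrow> nat) \<Rightarrow> (nat \<Rightarrow> (nat \<Rightarrow> real) set) \<Rightarrow>
    (nat \<Rightarrow>\<^sub>0 ((nat \<Rightarrow> real) \<Rightarrow>\<^sub>0 real)) dspace" where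
  "sum_of_free I d U \<equiv> direct_sum_dvs I (\<lambda>i. free_dvs (euclidean_dspace (d i) (U i)))"

lemma block_size_gt: "t < length js \<Longrightarrow> d (js ! t) < block_size d js"
  unfolding block_size_def by (auto simp: less_Suc_eq_le intro!: member_le_sum_list)

lemma openin_chart_dom:
  assumes "\<And>j. j \<in> set js \<Longrightarrow> openin (Euclidean_space (d j)) (U j)"
  shows "openin (Euclidean_space (chart_dim d js)) (chart_dom d U js)"
proof -
  let ?E = "Euclidean_space (chart_dim d js)"
  let ?P = "\<lambda>t. {x \<in> topspace ?E. block_point (block_size d js) (d (js ! t)) t x \<in> U (js ! t)}"
  have "openin ?E (?P t)" if "t < length js" for t
    unfolding block_point_def using that assms continuous_map_Euclidean_coordinate
    by (intro openin_Euclidean_preimage) auto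
  \<comment> \<open>The factor \<open>topspace ?E\<close> matters for \<open>js = []\<close>, when
    the intersection over positions is the whole type.\<close>
  then have "openin ?E ((\<Inter>t\<in>{..<length js}. ?P t) \<inter> topspace ?E)"
    by (intro openin_INT) auto
  moreover have "(\<Inter>t\<in>{..<length js}. ?P t) \<inter> topspace ?E = chart_dom d U js"
    unfolding chart_dom_def by auto
  ultimately show ?thesis by simp
qed

text \<open>Component \<open>j\<close> collects the positions \<open>t\<close> with
  \<open>js ! t = j\<close>, where coefficients and points are read off by coordinate functions,
  which are smooth. The local conditions hold on the whole chart domain at once.\<close>

lemma chart_plot:
  assumes U: "\<And>i. i \<in> I \<Longrightarrow> openin (Euclidean_space (d i)) (U i)" and js: "set js \<subseteq> I"
  shows "chart d js \<in> plots (sum_of_free I d U) (chart_dim d js) (chart_dom d U js)"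
proof -
  let ?M = "chart_dim d js" and ?V = "chart_dom d U js" and ?D = "block_size d js"
  have V: "openin (Euclidean_space ?M) ?V"
    using U js by (intro openin_chart_dom) auto
  have comp: "(\<lambda>x. Poly_Mapping.lookup (chart d js x) j)
      \<in> plots (free_dvs (euclidean_dspace (d j) (U j))) ?M ?V" if "j \<in> set js" for j
  proof -
    define A where "A = {t. t < length js \<and> js ! t = j}"
    have "finite A" unfolding A_def by simp
    \<comment> \<open>\<open>free_dvs\<close> indexes its sums by an initial segment of the
      naturals, so the positions in \<open>A\<close> are renumbered.\<close>
    then obtain e where e: "bij_betw e {..<card A} A"
      using ex_bij_betw_nat_finite atLeast0LessThan by metis
    have eA: "e i < length js" "js ! e i = j" if "i < card A" for i
      using bij_betwE[OF e] that unfolding A_def by auto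
    let ?r = "\<lambda>i. block_coef ?D (e i)" and ?q = "\<lambda>i. block_point ?D (d j) (e i)"
    have "smooth_fun ?M ?V (?r i)" for i
      unfolding block_coef_def using V by (rule smooth_fun_coordinate)
    moreover have "?q i \<in> plots (euclidean_dspace (d j) (U j)) ?M ?V" if "i < card A" for i
    proof -
      have "?q i ` ?V \<subseteq> U j"
        using eA[OF that] unfolding chart_dom_def by auto
      then show ?thesis
        using V U js \<open>j \<in> set js\<close>
        by (auto simp: euclidean_dspace_def smooth_map_def block_point_def intro: smooth_fun_coordinate)
    qed
    moreover have "Poly_Mapping.lookup (chart d js x) j =
        (\<Sum>i<card A. ?r i x *\<^sub>R Poly_Mapping.single (?q i x) 1)" for x
    proof -
      have "Poly_Mapping.lookup (chart d js x) j = (\<Sum>t<length js. if js ! t = j then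
          block_coef ?D t x *\<^sub>R Poly_Mapping.single (block_point ?D (d j) t x) 1 else 0)"
        unfolding chart_def lookup_sum lookup_single by (intro sum.cong) auto
      also have "\<dots> = (\<Sum>t\<in>A. block_coef ?D t x *\<^sub>R Poly_Mapping.single (block_point ?D (d j) t x) 1)"
        unfolding A_def by (simp add: sum.inter_filter[symmetric])
      also have "\<dots> = (\<Sum>i<card A. ?r i x *\<^sub>R Poly_Mapping.single (?q i x) 1)"
        by (rule sum.reindex_bij_betw[OF e, symmetric])
      finally show ?thesis .
    qed
    ultimately have "(\<forall>i<card A. smooth_fun ?M ?V (?r i) \<and>
          ?q i \<in> plots (euclidean_dspace (d j) (U j)) ?M ?V) \<and>
        (\<forall>v\<in>?V. Poly_Mapping.lookup (chart d js v) j =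
          (\<Sum>i<card A. ?r i v *\<^sub>R Poly_Mapping.single (?q i v) 1))"
      by blast
    then have "locally_on ?M ?V (\<lambda>W. \<exists>(k::nat) r q.
        (\<forall>i<k. smooth_fun ?M W (r i) \<and> q i \<in> plots (euclidean_dspace (d j) (U j)) ?M W) \<and>
        (\<forall>v\<in>W. Poly_Mapping.lookup (chart d js v) j =
          (\<Sum>i<k. r i v *\<^sub>R Poly_Mapping.single (q i v) 1)))"
      by (intro locally_onI[OF V] exI[of _ "card A"] exI[of _ ?r] exI[of _ ?q])
    then show ?thesis
      using V unfolding free_dvs_def by simp
  qed
  have keys: "Poly_Mapping.keys (chart d js x) \<subseteq> set js" for x
    unfolding chart_def by (rule order_trans[OF keys_sum]) (auto split: if_splits)
  have "locally_on ?M ?V (\<lambda>W. \<exists>J. finite J \<and> J \<subseteq> I \<and>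
      (\<forall>w\<in>W. Poly_Mapping.keys (chart d js w) \<subseteq> J) \<and>
      (\<forall>j\<in>J. (\<lambda>w. Poly_Mapping.lookup (chart d js w) j)
        \<in> plots (free_dvs (euclidean_dspace (d j) (U j))) ?M W))"
    using comp keys js by (intro locally_onI[OF V] exI[of _ "set js"]) simp
  then show ?thesis
    using V unfolding direct_sum_dvs_def by simp
qed

text \<open>A normal form for plots. The local formulas for the finitely many components
  \<open>j \<in> J\<close> hold on a common neighbourhood, and flattening the double index gives a
  single sum. Smoothness is recorded only as continuity, which is what the topological arguments
  use.\<close>

lemma sum_of_free_plot_local:
  assumes p: "p \<in> plots (sum_of_free I d U) n \<Omega>" and u: "u \<in> \<Omega>"
  obtains V T js r q where "openin (Euclidean_space n) V" "u \<in> V" "V \<subseteq> \<Omega>"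
    "\<And>t. t < T \<Longrightarrow> js t \<in> I"
    "\<And>t. t < T \<Longrightarrow> continuous_map (subtopology (Euclidean_space n) V) euclideanreal (r t)"
    "\<And>t c. t < T \<Longrightarrow> continuous_map (subtopology (Euclidean_space n) V) euclideanreal (\<lambda>v. q t v c)"
    "\<And>t v. t < T \<Longrightarrow> v \<in> V \<Longrightarrow> q t v \<in> U (js t)"
    "\<And>v. v \<in> V \<Longrightarrow> p v = (\<Sum>t<(T::nat). Poly_Mapping.single (js t)
       (r t v *\<^sub>R Poly_Mapping.single (q t v) 1))"
proof -
  let ?E = "Euclidean_space n" and ?X = "\<lambda>j. euclidean_dspace (d j) (U j)"
  have "locally_on n \<Omega> (\<lambda>W. \<exists>J. finite J \<and> J \<subseteq> I \<and>
      (\<forall>w\<in>W. Poly_Mapping.keys (p w) \<subseteq> J) \<and>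
      (\<forall>j\<in>J. (\<lambda>w. Poly_Mapping.lookup (p w) j) \<in> plots (free_dvs (?X j)) n W))"
    using p unfolding direct_sum_dvs_def by simp
  from locally_onD[OF this u] obtain W J where W: "openin ?E W" "u \<in> W" "W \<subseteq> \<Omega>" and J: "finite J" "J \<subseteq> I"
    and keys: "\<forall>w\<in>W. Poly_Mapping.keys (p w) \<subseteq> J"
    and comp: "\<forall>j\<in>J. (\<lambda>w. Poly_Mapping.lookup (p w) j) \<in> plots (free_dvs (?X j)) n W"
    by blast
  define Rep where "Rep j V k r q \<longleftrightarrow> openin ?E V \<and> u \<in> V \<and>
      (\<forall>i<k. smooth_fun n V (r i) \<and> q i \<in> plots (?X j) n V) \<and>
      (\<forall>v\<in>V. Poly_Mapping.lookup (p v) j = (\<Sum>i<k. r i v *\<^sub>R Poly_Mapping.single (q i v) 1))"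
    for j V and k :: nat and r q
  have "\<exists>V k r q. Rep j V k r q" if "j \<in> J" for j
  proof -
    have "locally_on n W (\<lambda>V. \<exists>(k::nat) r q.
        (\<forall>i<k. smooth_fun n V (r i) \<and> q i \<in> plots (?X j) n V) \<and>
        (\<forall>v\<in>V. Poly_Mapping.lookup (p v) j = (\<Sum>i<k. r i v *\<^sub>R Poly_Mapping.single (q i v) 1)))"
      using comp that unfolding free_dvs_def by simp
    from locally_onD[OF this W(2)] show ?thesis
      unfolding Rep_def by blast
  qed
  then obtain V k r q where Rep: "\<And>j. j \<in> J \<Longrightarrow> Rep j (V j) (k j) (r j) (q j)"
    by metis
  have V: "openin ?E (V j)" "u \<in> V j" if "j \<in> J" for j
    using Rep[OF that] unfolding Rep_def by auto
  have rq: "smooth_fun n (V j) (r j i)" "q j i \<in> plots (?X j) n (V j)"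
    if "j \<in> J" "i < k j" for j i
    using Rep[OF that(1)] that(2) unfolding Rep_def by auto
  have sum: "Poly_Mapping.lookup (p v) j = (\<Sum>i<k j. r j i v *\<^sub>R Poly_Mapping.single (q j i v) 1)"
    if "j \<in> J" "v \<in> V j" for j v
    using Rep[OF that(1)] that(2) unfolding Rep_def by auto
  \<comment> \<open>Intersecting with \<open>W\<close> keeps the support of \<open>p v\<close>
    inside \<open>J\<close>, which settles the components outside \<open>J\<close> below.\<close>
  define N where "N = ((\<Inter>j\<in>J. V j) \<inter> topspace ?E) \<inter> W"
  have NV: "N \<subseteq> V j" if "j \<in> J" for j
    unfolding N_def using that by blast
  \<comment> \<open>Pairs of a component and a term of its local formula; enumerating them by
    \<open>e\<close> yields the single index \<open>t\<close>.\<close>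
  define \<Sigma> where "\<Sigma> = Sigma J (\<lambda>j. {..<k j})"
  have "finite \<Sigma>" unfolding \<Sigma>_def using J(1) by simp
  then obtain e where e: "bij_betw e {..<card \<Sigma>} \<Sigma>"
    using ex_bij_betw_nat_finite atLeast0LessThan by metis
  have e\<Sigma>: "fst (e t) \<in> J" "snd (e t) < k (fst (e t))" if "t < card \<Sigma>" for t
    using bij_betwE[OF e] that unfolding \<Sigma>_def by force+
  show ?thesis
  proof
    show "openin ?E N"
      unfolding N_def using V W(1) J(1) by (intro openin_Int openin_INT) auto
    show "u \<in> N"
      unfolding N_def using V W openin_subset by blast
    show "N \<subseteq> \<Omega>"
      unfolding N_def using W by blast
    fix t assume t: "t < card \<Sigma>"
    let ?j = "fst (e t)" and ?i = "snd (e t)"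
    note rq' = rq[OF e\<Sigma>[OF t]] and NV' = NV[OF e\<Sigma>(1)[OF t]]
    show "?j \<in> I"
      using e\<Sigma>(1)[OF t] J by blast
    show "continuous_map (subtopology ?E N) euclideanreal (r ?j ?i)"
      using rq' NV' smooth_fun_continuous continuous_map_from_subtopology_mono by blast
    have q: "smooth_map n (V ?j) (d ?j) (U ?j) (q ?j ?i)"
      using rq' by (simp add: euclidean_dspace_def)
    show "continuous_map (subtopology ?E N) euclideanreal (\<lambda>v. q ?j ?i v c)" for c
      using smooth_map_continuous_coordinate[OF q] NV' continuous_map_from_subtopology_mono by blast
    show "q ?j ?i v \<in> U ?j" if "v \<in> N" for v
      using q NV' that unfolding smooth_map_def by blast
  next
    fix v assume v: "v \<in> N"
    let ?X = "\<lambda>j i. r j i v *\<^sub>R Poly_Mapping.single (q j i v) 1"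
    have "p v = (\<Sum>(j, i)\<in>\<Sigma>. Poly_Mapping.single j (?X j i))"
    proof (rule poly_mapping_eqI)
      fix l
      have "Poly_Mapping.lookup (\<Sum>(j, i)\<in>\<Sigma>. Poly_Mapping.single j (?X j i)) l =
          (\<Sum>(j, i)\<in>\<Sigma>. if j = l then ?X j i else 0)"
        unfolding lookup_sum by (intro sum.cong) (auto simp: lookup_single when_def)
      also have "\<dots> = (\<Sum>j\<in>J. \<Sum>i<k j. if j = l then ?X j i else 0)"
        unfolding \<Sigma>_def using J(1) by (subst sum.Sigma) auto
      also have "\<dots> = (\<Sum>j\<in>J. if j = l then (\<Sum>i<k j. ?X j i) else 0)"
        by (intro sum.cong) auto
      also have "\<dots> = (\<Sum>j\<in>J. if j = l then Poly_Mapping.lookup (p v) j else 0)"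
        using sum[OF _ subsetD[OF NV v]] by (intro sum.cong) auto
      also have "\<dots> = (if l \<in> J then Poly_Mapping.lookup (p v) l else 0)"
        using J(1) by (simp add: sum.delta)
      also have "\<dots> = Poly_Mapping.lookup (p v) l"
      proof (cases "l \<in> J")
        case False
        then have "l \<notin> Poly_Mapping.keys (p v)" using keys v unfolding N_def by blast
        then show ?thesis using False by (simp add: in_keys_iff)
      qed simp
      finally show "Poly_Mapping.lookup (p v) l =
        Poly_Mapping.lookup (\<Sum>(j, i)\<in>\<Sigma>. Poly_Mapping.single j (?X j i)) l" by simp
    qed
    also have "\<dots> = (\<Sum>t<card \<Sigma>. case e t of (j, i) \<Rightarrow> Poly_Mapping.single j (?X j i))"
      by (rule sum.reindex_bij_betw[OF e, symmetric])
    finally show "p v = (\<Sum>t<card \<Sigma>. Poly_Mapping.single (fst (e t)) (?X (fst (e t)) (snd (e t))))"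
      by (simp add: case_prod_unfold)
  qed
qed

text \<open>The coefficients and points of the normal form are written into blocks. The resulting
  \<open>h\<close> is continuous because each slot holds a coefficient or a coordinate of a
  point.\<close>

lemma sum_of_free_plot_factors:
  assumes U: "\<And>i. i \<in> I \<Longrightarrow> openin (Euclidean_space (d i)) (U i)"
    and p: "p \<in> plots (sum_of_free I d U) n \<Omega>" and u: "u \<in> \<Omega>"
  obtains V js h where "openin (Euclidean_space n) V" "u \<in> V" "V \<subseteq> \<Omega>" "set js \<subseteq> I"
    "continuous_map (subtopology (Euclidean_space n) V) (Euclidean_space (chart_dim d js)) h"
    "h ` V \<subseteq> chart_dom d U js" "\<And>v. v \<in> V \<Longrightarrow> p v = chart d js (h v)"
proof -
  let ?E = "Euclidean_space n"
  obtain V T j r q where V: "openin ?E V" "u \<in> V" "V \<subseteq> \<Omega>"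
    and j: "\<And>t. t < T \<Longrightarrow> j t \<in> I"
    and r: "\<And>t. t < T \<Longrightarrow> continuous_map (subtopology ?E V) euclideanreal (r t)"
    and q: "\<And>t c. t < T \<Longrightarrow> continuous_map (subtopology ?E V) euclideanreal (\<lambda>v. q t v c)"
    and qU: "\<And>t v. t < T \<Longrightarrow> v \<in> V \<Longrightarrow> q t v \<in> U (j t)"
    and sum: "\<And>v. v \<in> V \<Longrightarrow> p v = (\<Sum>t<(T::nat). Poly_Mapping.single (j t)
       (r t v *\<^sub>R Poly_Mapping.single (q t v) 1))"
    by (rule sum_of_free_plot_local[OF p u]) blast
  define js where "js = map j [0..<T]"
  have len: "length js = T" and nth: "\<And>t. t < T \<Longrightarrow> js ! t = j t"
    unfolding js_def by simp_all
  define D where "D = block_size d js"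
  have D: "d (j t) < D" if "t < T" for t
    using block_size_gt[of t js d] that unfolding D_def by (simp add: len nth)
  have dim: "chart_dim d js = T * D"
    unfolding chart_dim_def D_def len ..
  \<comment> \<open>Slot \<open>m\<close> belongs to block \<open>m div D\<close>: offset 0 is the
    coefficient, offset \<open>Suc c\<close> is coordinate \<open>c\<close> of the point.\<close>
  define h where "h v = (\<lambda>m. if m < T * D
     then (if m mod D = 0 then r (m div D) v else q (m div D) v (m mod D - 1)) else 0)" for v
  have block: "t * D + c < T * D" "(t * D + c) div D = t" "(t * D + c) mod D = c" if "t < T" "c < D" for t c
  proof -
    have "Suc t * D \<le> T * D" using that by (intro mult_le_mono1) simp
    then show "t * D + c < T * D" using that by simp
  qed (use that in auto)
  have coef: "block_coef D t (h v) = r t v" if "t < T" for t v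
    using block[OF that, of 0] D[OF that] unfolding block_coef_def h_def by auto
  have point: "block_point D (d (j t)) t (h v) = q t v" if t: "t < T" and v: "v \<in> V" for t v
  proof
    fix c
    show "block_point D (d (j t)) t (h v) c = q t v c"
    proof (cases "c < d (j t)")
      case True
      then show ?thesis
        using block[OF t, of "Suc c"] D[OF t] unfolding block_point_def h_def by simp
    next
      \<comment> \<open>From \<open>d (j t)\<close> on both sides vanish, the right one because
        \<open>U (j t)\<close> lies in \<open>Euclidean_space (d (j t))\<close>.\<close>
      case False
      have "q t v \<in> topspace (Euclidean_space (d (j t)))"
        using qU[OF t v] U[OF j[OF t]] openin_subset by blast
      then show ?thesis
        using False unfolding block_point_def by (simp add: topspace_Euclidean_space)
    qed
  qed
  show ?thesis
  proof
    show "set js \<subseteq> I" unfolding js_def using j by auto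
    show cont: "continuous_map (subtopology ?E V) (Euclidean_space (chart_dim d js)) h"
      unfolding h_def dim continuous_map_componentwise_Euclidean_space
    proof (intro allI impI)
      fix m assume "m < T * D"
      then have "m div D < T" by (simp add: less_mult_imp_div_less)
      then show "continuous_map (subtopology ?E V) euclideanreal
          (\<lambda>v. if m mod D = 0 then r (m div D) v else q (m div D) v (m mod D - 1))"
        using r q by simp
    qed
    show "h ` V \<subseteq> chart_dom d U js"
    proof clarify
      fix v assume v: "v \<in> V"
      have "h v \<in> topspace (Euclidean_space (chart_dim d js))"
        unfolding dim h_def topspace_Euclidean_space by simp
      then show "h v \<in> chart_dom d U js"
        using point v qU unfolding chart_dom_def len D_def[symmetric] by (simp add: nth)
    qed
    show "p v = chart d js (h v)" if v: "v \<in> V" for v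
      unfolding sum[OF v] chart_def len D_def[symmetric]
      by (intro sum.cong) (simp_all add: nth coef point v)
  qed (use V in auto)
qed

section \<open>Linear extensions of real functions to free vector spaces\<close>

definition pairing :: "('b \<Rightarrow> real) \<Rightarrow> ('b \<Rightarrow>\<^sub>0 real) \<Rightarrow> real" where
  "pairing f g = (\<Sum>a\<in>Poly_Mapping.keys g. Poly_Mapping.lookup g a * f a)"

text \<open>A common finite \<open>B\<close> in place of the varying supports lets several arguments
  be compared term by term.\<close>

lemma pairing_eq:
  assumes "finite B" "Poly_Mapping.keys g \<subseteq> B"
  shows "pairing f g = (\<Sum>a\<in>B. Poly_Mapping.lookup g a * f a)"
  unfolding pairing_def using assms by (intro sum.mono_neutral_left) (auto simp: in_keys_iff)

lemma pairing_sum: "finite A \<Longrightarrow> pairing f (\<Sum>t\<in>A. g t) = (\<Sum>t\<in>A. pairing f (g t))"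
proof -
  assume A: "finite A"
  let ?B = "\<Union>t\<in>A. Poly_Mapping.keys (g t)"
  have B: "finite ?B" using A by simp
  have "pairing f (\<Sum>t\<in>A. g t) = (\<Sum>a\<in>?B. \<Sum>t\<in>A. Poly_Mapping.lookup (g t) a * f a)"
    by (subst pairing_eq[OF B keys_sum]) (simp add: lookup_sum sum_distrib_right)
  also have "\<dots> = (\<Sum>t\<in>A. \<Sum>a\<in>?B. Poly_Mapping.lookup (g t) a * f a)"
    by (rule sum.swap)
  also have "\<dots> = (\<Sum>t\<in>A. pairing f (g t))"
    by (intro sum.cong refl pairing_eq[OF B, symmetric]) blast
  finally show ?thesis .
qed

lemma pairing_scaleR_single: "pairing f (c *\<^sub>R Poly_Mapping.single a 1) = c * f a"
  by (subst pairing_eq[of "{a}"]) (auto simp: scaleR_poly_mapping.rep_eq in_keys_iff lookup_single when_def split: if_splits)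

lemma pairing_zero: "pairing f 0 = 0"
  by (simp add: pairing_def)

text \<open>In the normal form, the pairing with component \<open>j\<close> is the finite sum of
  \<open>r t v * f (q t v)\<close> over the \<open>t\<close> with \<open>js t = j\<close>, which is
  continuous in \<open>v\<close>.\<close>

lemma pairing_sum_of_free_plot:
  fixes f :: "(nat \<Rightarrow> real) \<Rightarrow> real"
  assumes p: "p \<in> plots (sum_of_free I d U) n \<Omega>" and f: "continuous_on UNIV f"
    and G: "open (G :: real set)"
  shows "openin (Euclidean_space n) {u \<in> \<Omega>. pairing f (Poly_Mapping.lookup (p u) j) \<in> G}"
proof (rule openin_locally)
  let ?E = "Euclidean_space n"
  fix u assume "u \<in> {u \<in> \<Omega>. pairing f (Poly_Mapping.lookup (p u) j) \<in> G}"
  then have "u \<in> \<Omega>" by simp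
  then obtain V T js r q where V: "openin ?E V" "u \<in> V" "V \<subseteq> \<Omega>"
    and "\<And>t. t < T \<Longrightarrow> js t \<in> I"
    and r: "\<And>t. t < T \<Longrightarrow> continuous_map (subtopology ?E V) euclideanreal (r t)"
    and q: "\<And>t c. t < T \<Longrightarrow> continuous_map (subtopology ?E V) euclideanreal (\<lambda>v. q t v c)"
    and "\<And>t v. t < T \<Longrightarrow> v \<in> V \<Longrightarrow> q t v \<in> U (js t)"
    and sum: "\<And>v. v \<in> V \<Longrightarrow> p v = (\<Sum>t<(T::nat). Poly_Mapping.single (js t)
       (r t v *\<^sub>R Poly_Mapping.single (q t v) 1))"
    by (rule sum_of_free_plot_local[OF p]) blast
  have cq: "continuous_map (subtopology ?E V) euclideanreal (\<lambda>v. f (q t v))" if "t < T" for t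
  proof -
    have "continuous_map (subtopology ?E V) euclidean (q t)"
      unfolding euclidean_product_topology[symmetric] continuous_map_componentwise_UNIV
      using q[OF that] by simp
    moreover have "continuous_map euclidean euclideanreal f"
      using f by simp
    ultimately show ?thesis
      using continuous_map_compose[of _ _ "q t" _ f] by (simp add: comp_def)
  qed
  have "continuous_map (subtopology ?E V) euclideanreal
      (\<lambda>v. \<Sum>t<T. if js t = j then r t v * f (q t v) else 0)"
    using r cq by (intro continuous_map_sum) (auto intro: continuous_map_real_mult)
  moreover have "(\<Sum>t<T. if js t = j then r t v * f (q t v) else 0) =
      pairing f (Poly_Mapping.lookup (p v) j)" if "v \<in> V" for v
    unfolding sum[OF that] lookup_sum
    by (subst pairing_sum) (auto intro!: sum.cong simp: lookup_single pairing_scaleR_single pairing_zero when_def)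
  ultimately have "continuous_map (subtopology ?E V) euclideanreal
      (\<lambda>v. pairing f (Poly_Mapping.lookup (p v) j))"
    by (rule continuous_map_eq) auto
  then have "openin (subtopology ?E V)
      {v \<in> topspace (subtopology ?E V). pairing f (Poly_Mapping.lookup (p v) j) \<in> G}"
    by (rule openin_continuous_map_preimage) (use G in simp)
  moreover have "{v \<in> topspace (subtopology ?E V). pairing f (Poly_Mapping.lookup (p v) j) \<in> G} =
      V \<inter> {u \<in> \<Omega>. pairing f (Poly_Mapping.lookup (p u) j) \<in> G}"
    using V openin_subset[OF V(1)] by auto
  ultimately have "openin ?E (V \<inter> {u \<in> \<Omega>. pairing f (Poly_Mapping.lookup (p u) j) \<in> G})"
    using V(1) by (simp add: openin_open_subtopology)
  then show "\<exists>V. openin ?E V \<and> u \<in> V \<and>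
      openin ?E (V \<inter> {u \<in> \<Omega>. pairing f (Poly_Mapping.lookup (p u) j) \<in> G})"
    using V by blast
qed

text \<open>Where \<open>g\<close> and \<open>g'\<close> differ at \<open>a\<close>, the product of
  the distances to the other points of both supports vanishes at those points but not at
  \<open>a\<close>. Pairing with it reads off the coefficient at \<open>a\<close> up to a nonzero
  factor.\<close>

lemma pairing_separates:
  fixes g g' :: "'b::metric_space \<Rightarrow>\<^sub>0 real"
  assumes "g \<noteq> g'"
  obtains f where "continuous_on UNIV f" "pairing f g \<noteq> pairing f g'"
proof -
  obtain a where a: "Poly_Mapping.lookup g a \<noteq> Poly_Mapping.lookup g' a"
    using assms poly_mapping_eqI by metis
  define B where "B = insert a (Poly_Mapping.keys g \<union> Poly_Mapping.keys g')"
  define f where "f z = (\<Prod>b\<in>B - {a}. dist z b)" for z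
  have B: "finite B" "Poly_Mapping.keys g \<subseteq> B" "Poly_Mapping.keys g' \<subseteq> B" "a \<in> B"
    unfolding B_def by auto
  have f0: "f b = 0" if "b \<in> B - {a}" for b
    unfolding f_def using that B(1) by (auto simp: prod_zero_iff)
  have "pairing f h = Poly_Mapping.lookup h a * f a" if "Poly_Mapping.keys h \<subseteq> B" for h
    using pairing_eq[OF B(1) that, of f] sum.remove[OF B(1,4), of "\<lambda>b. Poly_Mapping.lookup h b * f b"] f0
    by simp
  moreover have "f a \<noteq> 0"
    unfolding f_def using B(1) by (auto simp: prod_zero_iff)
  ultimately have "pairing f g \<noteq> pairing f g'"
    using a B by simp
  moreover have "continuous_on UNIV f"
    unfolding f_def by (intro continuous_intros)
  ultimately show ?thesis using that by blast
qed

section \<open>Atlases and products\<close>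

text \<open>\<open>T\<close> carries the final topology of countably many maps from open Euclidean
  sets that jointly cover it. These charts may fail to be injective.\<close>

locale euclidean_atlas =
  fixes T :: "'a topology" and A :: "'i set" and N :: "'i \<Rightarrow> nat"
    and V :: "'i \<Rightarrow> (nat \<Rightarrow> real) set" and \<phi> :: "'i \<Rightarrow> (nat \<Rightarrow> real) \<Rightarrow> 'a"
  assumes Hausdorff: "Hausdorff_space T"
    and countable: "countable A"
    and dom: "a \<in> A \<Longrightarrow> openin (Euclidean_space (N a)) (V a)"
    and continuous: "a \<in> A \<Longrightarrow> continuous_map (subtopology (Euclidean_space (N a)) (V a)) T (\<phi> a)"
    and cover: "topspace T \<subseteq> (\<Union>a\<in>A. \<phi> a ` V a)"
    and determined: "S \<subseteq> topspace T \<Longrightarrow>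
      (\<And>a. a \<in> A \<Longrightarrow> openin (Euclidean_space (N a)) {x \<in> V a. \<phi> a x \<in> S}) \<Longrightarrow> openin T S"
begin

text \<open>The pieces are the chart images of countably many compact sets exhausting the chart
  domains. The second conclusion remembers the chart behind each piece, for use in products.\<close>

lemma compact_cover:
  obtains \<C> where "k_omega_cover T \<C>"
    "\<And>C. C \<in> \<C> \<Longrightarrow> \<exists>a\<in>A. \<exists>D. compactin (Euclidean_space (N a)) D \<and> D \<subseteq> V a \<and> C = \<phi> a ` D"
proof -
  have "\<exists>\<K>. countable \<K> \<and> (\<forall>C\<in>\<K>. compactin (Euclidean_space (N a)) C \<and> C \<subseteq> V a) \<and>
      (\<forall>x\<in>V a. \<exists>C\<in>\<K>. \<exists>W. openin (Euclidean_space (N a)) W \<and> x \<in> W \<and> W \<subseteq> C)" if "a \<in> A" for a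
    using open_compact_pieces[OF dom[OF that]] by metis
  then obtain \<K> where \<K>: "\<And>a. a \<in> A \<Longrightarrow> countable (\<K> a) \<and>
      (\<forall>C\<in>\<K> a. compactin (Euclidean_space (N a)) C \<and> C \<subseteq> V a) \<and>
      (\<forall>x\<in>V a. \<exists>C\<in>\<K> a. \<exists>W. openin (Euclidean_space (N a)) W \<and> x \<in> W \<and> W \<subseteq> C)"
    by metis
  define \<C> where "\<C> = (\<Union>a\<in>A. (\<lambda>D. \<phi> a ` D) ` \<K> a)"
  have \<C>: "\<exists>a\<in>A. \<exists>D. compactin (Euclidean_space (N a)) D \<and> D \<subseteq> V a \<and> C = \<phi> a ` D" if "C \<in> \<C>" for C
    using that \<K> unfolding \<C>_def by blast
  have compact: "compactin T C" if "C \<in> \<C>" for C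
  proof -
    obtain a D where "a \<in> A" "compactin (Euclidean_space (N a)) D" "D \<subseteq> V a" "C = \<phi> a ` D"
      using \<C>[OF \<open>C \<in> \<C>\<close>] by blast
    then show ?thesis
      using image_compactin[OF _ continuous] by (simp add: compactin_subtopology)
  qed
  have "k_omega_cover T \<C>"
  proof
    show "countable \<C>"
      unfolding \<C>_def using countable \<K> by (intro countable_UN countable_image) auto
    show "\<Union>\<C> = topspace T"
    proof (intro subset_antisym subsetI)
      fix y assume "y \<in> topspace T"
      then obtain a x where ax: "a \<in> A" "x \<in> V a" "y = \<phi> a x"
        using cover by blast
      then obtain D where "D \<in> \<K> a" "x \<in> D"
        using \<K>[OF ax(1)] by blast
      then show "y \<in> \<Union>\<C>"
        unfolding \<C>_def using ax by blast
    next
      fix y assume "y \<in> \<Union>\<C>"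
      then show "y \<in> topspace T"
        using compact compactin_subset_topspace by blast
    qed
    show "openin T S" if S: "S \<subseteq> topspace T"
      and SC: "\<And>C. C \<in> \<C> \<Longrightarrow> openin (subtopology T C) (S \<inter> C)" for S
    proof (rule determined[OF S])
      fix a assume a: "a \<in> A"
      let ?E = "Euclidean_space (N a)"
      show "openin ?E {x \<in> V a. \<phi> a x \<in> S}"
      proof (rule openin_locally)
        fix x assume "x \<in> {x \<in> V a. \<phi> a x \<in> S}"
        then obtain D W where D: "D \<in> \<K> a" "D \<subseteq> V a" and W: "openin ?E W" "x \<in> W" "W \<subseteq> D"
          using \<K>[OF a] by blast
        have "\<phi> a ` D \<in> \<C>"
          unfolding \<C>_def using a D by blast
        \<comment> \<open>Over the neighbourhood \<open>W \<subseteq> D\<close> the open set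
          \<open>G\<close> has the same preimage as \<open>S\<close>, so openness passes from the
          image piece back to the chart.\<close>
        then obtain G where G: "openin T G" "S \<inter> \<phi> a ` D = G \<inter> \<phi> a ` D"
          using SC unfolding openin_subtopology by blast
        have "openin (subtopology ?E (V a)) {x \<in> topspace (subtopology ?E (V a)). \<phi> a x \<in> G}"
          using continuous[OF a] G(1) by (rule openin_continuous_map_preimage)
        moreover have "{x \<in> topspace (subtopology ?E (V a)). \<phi> a x \<in> G} = {x \<in> V a. \<phi> a x \<in> G}"
          using openin_subset[OF dom[OF a]] by auto
        ultimately have "openin ?E {x \<in> V a. \<phi> a x \<in> G}"
          using dom[OF a] by (simp add: openin_open_subtopology)
        then have "openin ?E (W \<inter> {x \<in> V a. \<phi> a x \<in> G})"
          using W(1) by blast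
        moreover have "W \<inter> {x \<in> V a. \<phi> a x \<in> G} = W \<inter> {x \<in> V a. \<phi> a x \<in> S}"
          using G(2) W(3) by blast
        ultimately show "\<exists>W. openin ?E W \<and> x \<in> W \<and> openin ?E (W \<inter> {x \<in> V a. \<phi> a x \<in> S})"
          using W by auto
      qed
    qed
  qed (use Hausdorff compact in auto)
  then show ?thesis
    using that \<C> by blast
qed

lemma exhaustion: "\<exists>K. k_omega_exhaustion T K"
  using compact_cover k_omega_cover.exhaustion by metis

end

text \<open>Openness of the preimages in products of charts becomes relative openness on images of
  compact rectangles, and that suffices for the product topology.\<close>

lemma euclidean_atlas_prod_openin:
  assumes "euclidean_atlas S A M V \<phi>" "euclidean_atlas T B N W \<psi>"
    and Q: "Q \<subseteq> topspace S \<times> topspace T"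
    and charts: "\<And>a b. a \<in> A \<Longrightarrow> b \<in> B \<Longrightarrow>
      openin (prod_topology (Euclidean_space (M a)) (Euclidean_space (N b)))
        {(x, y) \<in> V a \<times> W b. (\<phi> a x, \<psi> b y) \<in> Q}"
  shows "openin (prod_topology S T) Q"
proof -
  interpret S: euclidean_atlas S A M V \<phi> by fact
  interpret T: euclidean_atlas T B N W \<psi> by fact
  obtain \<C> where \<C>: "k_omega_cover S \<C>"
    "\<And>C. C \<in> \<C> \<Longrightarrow> \<exists>a\<in>A. \<exists>D. compactin (Euclidean_space (M a)) D \<and> D \<subseteq> V a \<and> C = \<phi> a ` D"
    by (rule S.compact_cover) blast
  obtain \<D> where \<D>: "k_omega_cover T \<D>"
    "\<And>C. C \<in> \<D> \<Longrightarrow> \<exists>b\<in>B. \<exists>D. compactin (Euclidean_space (N b)) D \<and> D \<subseteq> W b \<and> C = \<psi> b ` D"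
    by (rule T.compact_cover) blast
  show ?thesis
  proof (rule k_omega_cover_prod_openin[OF \<C>(1) \<D>(1) Q])
    fix C D assume "C \<in> \<C>" "D \<in> \<D>"
    then obtain a b C' D' where ab: "a \<in> A" "b \<in> B"
      and C': "compactin (Euclidean_space (M a)) C'" "C' \<subseteq> V a" "C = \<phi> a ` C'"
      and D': "compactin (Euclidean_space (N b)) D'" "D' \<subseteq> W b" "D = \<psi> b ` D'"
      using \<C>(2) \<D>(2) by meson
    have "openin (subtopology (prod_topology (Euclidean_space (M a)) (Euclidean_space (N b))) (V a \<times> W b))
        {(x, y) \<in> V a \<times> W b. (\<phi> a x, \<psi> b y) \<in> Q}"
      using charts[OF ab] unfolding openin_subtopology by (intro exI conjI) auto
    then show "openin (subtopology (prod_topology S T) (C \<times> D)) (Q \<inter> C \<times> D)"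
      unfolding C'(3) D'(3)
      using compact_images_prod_openin S.continuous[OF ab(1)] T.continuous[OF ab(2)]
        S.Hausdorff T.Hausdorff C'(1,2) D'(1,2) by blast
  qed
qed

section \<open>Products of open sets inside one Euclidean space\<close>

definition left_part :: "nat \<Rightarrow> (nat \<Rightarrow> real) \<Rightarrow> (nat \<Rightarrow> real)" where
  "left_part M x = (\<lambda>c. if c < M then x c else 0)"

definition right_part :: "nat \<Rightarrow> nat \<Rightarrow> (nat \<Rightarrow> real) \<Rightarrow> (nat \<Rightarrow> real)" where
  "right_part M N x = (\<lambda>c. if c < N then x (M + c) else 0)"

text \<open>A plot has its domain in a single Euclidean space, so the product of \<open>V\<close>
  and \<open>W\<close> is realised by concatenating coordinates.\<close>

definition product_dom :: "nat \<Rightarrow> (nat \<Rightarrow> real) set \<Rightarrow> nat \<Rightarrow> (nat \<Rightarrow> real) set \<Rightarrow> (nat \<Rightarrow> real) set" where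
  "product_dom M V N W = {x \<in> topspace (Euclidean_space (M + N)). left_part M x \<in> V \<and> right_part M N x \<in> W}"

lemma openin_product_dom:
  assumes "openin (Euclidean_space M) V" "openin (Euclidean_space N) W"
  shows "openin (Euclidean_space (M + N)) (product_dom M V N W)"
proof -
  let ?E = "Euclidean_space (M + N)"
  have "openin ?E ({x \<in> topspace ?E. left_part M x \<in> V} \<inter> {x \<in> topspace ?E. right_part M N x \<in> W})"
    unfolding left_part_def right_part_def
    using assms by (intro openin_Int openin_Euclidean_preimage continuous_map_Euclidean_coordinate)
  moreover have "{x \<in> topspace ?E. left_part M x \<in> V} \<inter> {x \<in> topspace ?E. right_part M N x \<in> W} = product_dom M V N W"
    unfolding product_dom_def by auto
  ultimately show ?thesis by simp
qed

lemma smooth_map_left_part: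
  assumes "openin (Euclidean_space M) V" "openin (Euclidean_space N) W"
  shows "smooth_map (M + N) (product_dom M V N W) M V (left_part M)"
  using assms openin_product_dom[OF assms] unfolding smooth_map_def
  by (auto simp: left_part_def smooth_fun_coordinate product_dom_def)

lemma smooth_map_right_part:
  assumes "openin (Euclidean_space M) V" "openin (Euclidean_space N) W"
  shows "smooth_map (M + N) (product_dom M V N W) N W (right_part M N)"
  using assms openin_product_dom[OF assms] unfolding smooth_map_def
  by (auto simp: right_part_def smooth_fun_coordinate product_dom_def)

text \<open>The pair of \<open>\<phi>\<close> and \<open>\<psi>\<close>, read on concatenated
  coordinates, is a plot of the product, so its preimage of \<open>Q\<close> is open there. The
  continuous map \<open>join\<close> carries this back to the product topology.\<close>

lemma prod_plot_preimage:
  assumes Q: "\<And>n \<Omega> p. p \<in> plots (prod_dspace X Y) n \<Omega> \<Longrightarrow> openin (Euclidean_space n) {u \<in> \<Omega>. p u \<in> Q}"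
    and V: "openin (Euclidean_space M) V" and W: "openin (Euclidean_space N) W"
    and \<phi>: "\<phi> \<circ> left_part M \<in> plots X (M + N) (product_dom M V N W)"
    and \<psi>: "\<psi> \<circ> right_part M N \<in> plots Y (M + N) (product_dom M V N W)"
  shows "openin (prod_topology (Euclidean_space M) (Euclidean_space N))
    {(x, y) \<in> V \<times> W. (\<phi> x, \<psi> y) \<in> Q}"
proof -
  let ?P = "prod_topology (Euclidean_space M) (Euclidean_space N)"
  define p where "p x = (\<phi> (left_part M x), \<psi> (right_part M N x))" for x
  define join where "join z = (\<lambda>c. if c < M + N then (if c < M then fst z c else snd z (c - M)) else 0)"
    for z :: "(nat \<Rightarrow> real) \<times> (nat \<Rightarrow> real)"
  have "fst \<circ> p = \<phi> \<circ> left_part M" "snd \<circ> p = \<psi> \<circ> right_part M N"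
    unfolding p_def by auto
  then have "p \<in> plots (prod_dspace X Y) (M + N) (product_dom M V N W)"
    using \<phi> \<psi> by (simp add: prod_dspace_def)
  then have O: "openin (Euclidean_space (M + N)) {u \<in> product_dom M V N W. p u \<in> Q}"
    by (rule Q)
  have "continuous_map ?P euclideanreal (\<lambda>z. fst z c)" for c
    using continuous_map_compose[OF continuous_map_fst continuous_map_Euclidean_coordinate] by (simp add: comp_def)
  moreover have "continuous_map ?P euclideanreal (\<lambda>z. snd z c)" for c
    using continuous_map_compose[OF continuous_map_snd continuous_map_Euclidean_coordinate] by (simp add: comp_def)
  ultimately have "continuous_map ?P (Euclidean_space (M + N)) join"
    unfolding join_def by (auto simp: continuous_map_componentwise_Euclidean_space)
  then have open_preimage: "openin ?P {z \<in> topspace ?P. join z \<in> {u \<in> product_dom M V N W. p u \<in> Q}}"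
    using O by (rule openin_continuous_map_preimage)
  have "join z \<in> topspace (Euclidean_space (M + N))" for z
    by (simp add: join_def topspace_Euclidean_space)
  moreover have "left_part M (join (x, y)) = x" "right_part M N (join (x, y)) = y"
    if "(x, y) \<in> topspace ?P" for x y
    using that by (auto simp: left_part_def right_part_def join_def topspace_Euclidean_space fun_eq_iff)
  ultimately have "{z \<in> topspace ?P. join z \<in> {u \<in> product_dom M V N W. p u \<in> Q}} =
      topspace ?P \<inter> {(x, y) \<in> V \<times> W. (\<phi> x, \<psi> y) \<in> Q}"
    by (auto simp: product_dom_def p_def)
  also have "\<dots> = {(x, y) \<in> V \<times> W. (\<phi> x, \<psi> y) \<in> Q}"
    using openin_subset[OF V] openin_subset[OF W] by auto
  finally show ?thesis using open_preimage by simp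
qed

lemma diffeological_space_prod:
  assumes "diffeological_space X" "diffeological_space Y"
  shows "diffeological_space (prod_dspace X Y)"
proof -
  interpret X: diffeological_space X by fact
  interpret Y: diffeological_space Y by fact
  show ?thesis
  proof
    show "p ` \<Omega> \<subseteq> pts (prod_dspace X Y)" if "p \<in> plots (prod_dspace X Y) n \<Omega>" for p n \<Omega>
      using that X.plot_image[of "fst \<circ> p" n \<Omega>] Y.plot_image[of "snd \<circ> p" n \<Omega>]
      by (simp add: prod_dspace_def image_subset_iff mem_Times_iff)
    show "q \<in> plots (prod_dspace X Y) n \<Omega>"
      if "p \<in> plots (prod_dspace X Y) n \<Omega>" "\<And>u. u \<in> \<Omega> \<Longrightarrow> q u = p u" for p q n \<Omega>
      using that X.plot_cong[of "fst \<circ> p" n \<Omega> "fst \<circ> q"] Y.plot_cong[of "snd \<circ> p" n \<Omega> "snd \<circ> q"]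
      by (simp add: prod_dspace_def)
    show "(\<lambda>_. x) \<in> plots (prod_dspace X Y) n \<Omega>"
      if "openin (Euclidean_space n) \<Omega>" "x \<in> pts (prod_dspace X Y)" for n \<Omega> x
      using that X.plot_const[of n \<Omega> "fst x"] Y.plot_const[of n \<Omega> "snd x"]
      by (auto simp: prod_dspace_def comp_def)
    show "p \<circ> h \<in> plots (prod_dspace X Y) m W"
      if "p \<in> plots (prod_dspace X Y) n \<Omega>" "smooth_map m W n \<Omega> h" for p n \<Omega> m W h
      using that X.plot_comp[of "fst \<circ> p"] Y.plot_comp[of "snd \<circ> p"]
      by (auto simp: prod_dspace_def comp_assoc)
    show "p \<in> plots (prod_dspace X Y) n \<Omega>"
      if "openin (Euclidean_space n) \<Omega>" "\<Union>\<V> = \<Omega>"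
        "\<And>V. V \<in> \<V> \<Longrightarrow> openin (Euclidean_space n) V \<and> p \<in> plots (prod_dspace X Y) n V" for p n \<Omega> \<V>
      using that X.plot_local[of n \<Omega> \<V> "fst \<circ> p"] Y.plot_local[of n \<Omega> \<V> "snd \<circ> p"]
      by (simp add: prod_dspace_def)
  qed (auto simp: prod_dspace_def dest: X.plot_domain)
qed

text \<open>A single chart makes the real line available as a factor, for scalar
  multiplication.\<close>

lemma euclidean_atlas_real:
  "euclidean_atlas euclideanreal {()} (\<lambda>_. 1) (\<lambda>_. topspace (Euclidean_space 1)) (\<lambda>_ x. x 0)"
proof
  \<comment> \<open>A continuous section of the chart: the preimage under it of the chart preimage
    of \<open>S\<close> is \<open>S\<close> again.\<close>
  let ?e = "\<lambda>t c. if c < (1::nat) then (t::real) else (0::real)"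
  have e: "?e t \<in> topspace (Euclidean_space 1)" for t
    by (simp add: topspace_Euclidean_space)
  show "topspace euclideanreal \<subseteq> (\<Union>a\<in>{()}. (\<lambda>x. x 0) ` topspace (Euclidean_space 1))"
  proof
    fix t :: real
    show "t \<in> (\<Union>a\<in>{()}. (\<lambda>x. x 0) ` topspace (Euclidean_space 1))"
      using e[of t] by (auto intro!: image_eqI[of _ _ "?e t"])
  qed
  show "openin euclideanreal S"
    if "\<And>a. a \<in> {()} \<Longrightarrow> openin (Euclidean_space 1) {x \<in> topspace (Euclidean_space 1). x 0 \<in> S}" for S
  proof -
    have "continuous_map euclideanreal (Euclidean_space 1) ?e"
      unfolding continuous_map_componentwise_Euclidean_space by (simp del: One_nat_def)
    from openin_continuous_map_preimage[OF this that[of "()"]] e show ?thesis by simp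
  qed
qed (auto simp: continuous_map_Euclidean_coordinate Hausdorff_space_euclidean)

section \<open>Retracts of direct sums of free spaces\<close>

locale retract_of_sum_of_free = diffeological_vector_space P
  for P :: "'a::real_vector dspace" +
  fixes I d U s r
  assumes U: "i \<in> I \<Longrightarrow> openin (Euclidean_space (d i)) (U i)"
    and s: "dsmooth P (sum_of_free I d U) s"
    and r: "dsmooth (sum_of_free I d U) P r"
    and retract: "x \<in> pts P \<Longrightarrow> r (s x) = x"
begin

text \<open>\<open>s\<close> is injective because \<open>r\<close> inverts it, so distinct points
  have images that differ in some component, and a pairing separates these. Composed with
  \<open>s\<close> it has D-open preimages of open sets, as \<open>s\<close> carries plots to
  plots.\<close>

lemma D_Hausdorff: "Hausdorff_space (D_topology P)"
  unfolding Hausdorff_space_def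
proof (intro allI impI)
  fix x y assume "x \<in> topspace (D_topology P) \<and> y \<in> topspace (D_topology P) \<and> x \<noteq> y"
  then have xy: "x \<in> pts P" "y \<in> pts P" "x \<noteq> y"
    using topspace_D_topology[OF diffeological_space_axioms] by auto
  then have "s x \<noteq> s y"
    using retract by metis
  then obtain j where "Poly_Mapping.lookup (s x) j \<noteq> Poly_Mapping.lookup (s y) j"
    using poly_mapping_eqI by metis
  then obtain f where f: "continuous_on UNIV f"
    and "pairing f (Poly_Mapping.lookup (s x) j) \<noteq> pairing f (Poly_Mapping.lookup (s y) j)"
    by (rule pairing_separates)
  then obtain G H where GH: "open G" "open H" "pairing f (Poly_Mapping.lookup (s x) j) \<in> G"
    "pairing f (Poly_Mapping.lookup (s y) j) \<in> H" "G \<inter> H = {}"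
    using hausdorff by metis
  let ?pre = "\<lambda>G. {z \<in> pts P. pairing f (Poly_Mapping.lookup (s z) j) \<in> G}"
  have "openin (D_topology P) (?pre G)" if "open G" for G
    unfolding openin_D_topology[OF diffeological_space_axioms]
  proof (intro conjI allI ballI)
    fix n \<Omega> p assume p: "p \<in> plots P n \<Omega>"
    then have "s \<circ> p \<in> plots (sum_of_free I d U) n \<Omega>"
      using s unfolding dsmooth_def by blast
    from pairing_sum_of_free_plot[OF this f that, of j]
    show "openin (Euclidean_space n) {u \<in> \<Omega>. p u \<in> ?pre G}"
      using plot_image[OF p] by (auto elim!: back_subst[of "openin _"])
  qed auto
  then show "\<exists>G H. openin (D_topology P) G \<and> openin (D_topology P) H \<and> x \<in> G \<and> y \<in> H \<and> disjnt G H"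
    using GH xy by (intro exI[of _ "?pre G"] exI[of _ "?pre H"]) (auto simp: disjnt_iff)
qed

lemma retract_chart_plot: "js \<in> lists I \<Longrightarrow> r \<circ> chart d js \<in> plots P (chart_dim d js) (chart_dom d U js)"
  using r chart_plot[of I d U js] U unfolding dsmooth_def by blast

text \<open>\<open>s \<circ> p\<close> factors locally through a chart of the direct sum; applying
  \<open>r\<close> turns this into a factorisation of \<open>p\<close>, since
  \<open>r (s (p v)) = p v\<close>.\<close>

lemma plot_factors:
  assumes p: "p \<in> plots P n \<Omega>" and u: "u \<in> \<Omega>"
  obtains V js h where "openin (Euclidean_space n) V" "u \<in> V" "V \<subseteq> \<Omega>" "js \<in> lists I"
    "continuous_map (subtopology (Euclidean_space n) V) (Euclidean_space (chart_dim d js)) h"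
    "h ` V \<subseteq> chart_dom d U js" "\<And>v. v \<in> V \<Longrightarrow> p v = (r \<circ> chart d js) (h v)"
proof -
  have "s \<circ> p \<in> plots (sum_of_free I d U) n \<Omega>"
    using p s unfolding dsmooth_def by blast
  then obtain V js h where *: "openin (Euclidean_space n) V" "u \<in> V" "V \<subseteq> \<Omega>" "set js \<subseteq> I"
    "continuous_map (subtopology (Euclidean_space n) V) (Euclidean_space (chart_dim d js)) h"
    "h ` V \<subseteq> chart_dom d U js" "\<And>v. v \<in> V \<Longrightarrow> (s \<circ> p) v = chart d js (h v)"
    by (rule sum_of_free_plot_factors[OF U _ u, rotated]) blast
  have "p v = (r \<circ> chart d js) (h v)" if "v \<in> V" for v
  proof -
    have "p v \<in> pts P" using plot_image[OF p] *(3) that by blast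
    then show ?thesis using *(7)[OF that] retract by (metis comp_apply)
  qed
  then show ?thesis
    using that * by (simp add: lists_eq_set)
qed

lemma atlas:
  "euclidean_atlas (D_topology P) (lists I) (chart_dim d) (chart_dom d U) (\<lambda>js. r \<circ> chart d js)"
proof
  show "Hausdorff_space (D_topology P)" by (rule D_Hausdorff)
  \<comment> \<open>The indices are natural numbers, so there are only countably many finite lists
    of them.\<close>
  show "countable (lists I)" by simp
  show "openin (Euclidean_space (chart_dim d js)) (chart_dom d U js)" if "js \<in> lists I" for js
    using plot_domain[OF retract_chart_plot[OF that]] .
  show "continuous_map (subtopology (Euclidean_space (chart_dim d js)) (chart_dom d U js))
      (D_topology P) (r \<circ> chart d js)" if "js \<in> lists I" for js
    using continuous_map_D_topology_plot[OF diffeological_space_axioms retract_chart_plot[OF that]] .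
  show "topspace (D_topology P) \<subseteq> (\<Union>js\<in>lists I. (r \<circ> chart d js) ` chart_dom d U js)"
  proof
    fix x assume "x \<in> topspace (D_topology P)"
    then have x: "x \<in> pts P"
      using topspace_D_topology[OF diffeological_space_axioms] by simp
    \<comment> \<open>A constant plot on the one-point space factors through a chart, which puts
      \<open>x\<close> into the image of that chart.\<close>
    let ?E = "Euclidean_space 0"
    have "(\<lambda>_. x) \<in> plots P 0 (topspace ?E)"
      using x by (intro plot_const) auto
    moreover have "(\<lambda>_. 0) \<in> topspace ?E"
      by (simp add: topspace_Euclidean_space)
    ultimately obtain V js h where "openin ?E V" and V: "(\<lambda>_. 0) \<in> V"
      and "V \<subseteq> topspace ?E" and js: "js \<in> lists I"
      and "continuous_map (subtopology ?E V) (Euclidean_space (chart_dim d js)) h"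
      and h: "h ` V \<subseteq> chart_dom d U js"
      and x_eq: "\<And>v. v \<in> V \<Longrightarrow> x = (r \<circ> chart d js) (h v)"
      by (rule plot_factors) blast
    have "x = (r \<circ> chart d js) (h (\<lambda>_. 0))" "h (\<lambda>_. 0) \<in> chart_dom d U js"
      using x_eq[OF V] h V by auto
    then show "x \<in> (\<Union>js\<in>lists I. (r \<circ> chart d js) ` chart_dom d U js)"
      using js by blast
  qed
  show "openin (D_topology P) A" if A: "A \<subseteq> topspace (D_topology P)"
    and charts: "\<And>js. js \<in> lists I \<Longrightarrow> openin (Euclidean_space (chart_dim d js))
      {x \<in> chart_dom d U js. (r \<circ> chart d js) x \<in> A}" for A
    unfolding openin_D_topology[OF diffeological_space_axioms]
  proof (intro conjI allI ballI)
    show "A \<subseteq> pts P"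
      using A topspace_D_topology[OF diffeological_space_axioms] by simp
    fix n \<Omega> p assume p: "p \<in> plots P n \<Omega>"
    let ?E = "Euclidean_space n"
    show "openin ?E {u \<in> \<Omega>. p u \<in> A}"
    proof (rule openin_locally)
      fix u assume "u \<in> {u \<in> \<Omega>. p u \<in> A}"
      then have "u \<in> \<Omega>" by simp
      with p obtain V js h where V: "openin ?E V" "u \<in> V" "V \<subseteq> \<Omega>" and js: "js \<in> lists I"
        and h: "continuous_map (subtopology ?E V) (Euclidean_space (chart_dim d js)) h"
          "h ` V \<subseteq> chart_dom d U js"
        and ph: "\<And>v. v \<in> V \<Longrightarrow> p v = (r \<circ> chart d js) (h v)"
        by (rule plot_factors) blast
      \<comment> \<open>Near \<open>u\<close> the plot is a chart after the continuous
        \<open>h\<close>, so the preimage of \<open>A\<close> under \<open>p\<close> is the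
        \<open>h\<close>-preimage of an open set.\<close>
      have "openin (subtopology ?E V) {v \<in> topspace (subtopology ?E V).
          h v \<in> {x \<in> chart_dom d U js. (r \<circ> chart d js) x \<in> A}}"
        using h(1) charts[OF js] by (rule openin_continuous_map_preimage)
      moreover have "{v \<in> topspace (subtopology ?E V).
          h v \<in> {x \<in> chart_dom d U js. (r \<circ> chart d js) x \<in> A}} = V \<inter> {u \<in> \<Omega>. p u \<in> A}"
        using openin_subset[OF V(1)] V(3) h(2) ph by auto
      ultimately have "openin ?E (V \<inter> {u \<in> \<Omega>. p u \<in> A})"
        using V(1) by (simp add: openin_open_subtopology)
      then show "\<exists>V. openin ?E V \<and> u \<in> V \<and> openin ?E (V \<inter> {u \<in> \<Omega>. p u \<in> A})"
        using V by blast
    qed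
  qed
qed

section \<open>Product topologies and the vector space operations\<close>

lemma topspace_D: "topspace (D_topology P) = pts P"
  by (rule topspace_D_topology[OF diffeological_space_axioms])

text \<open>Two charts of \<open>P\<close> combine to a plot of \<open>prod_dspace P P\<close>, so
  openness along plots gives the chart condition of the product criterion. This serves both the
  equality of topologies and addition.\<close>

lemma openin_square:
  assumes Q: "Q \<subseteq> pts P \<times> pts P"
    and plots: "\<And>n \<Omega> p. p \<in> plots (prod_dspace P P) n \<Omega> \<Longrightarrow> openin (Euclidean_space n) {u \<in> \<Omega>. p u \<in> Q}"
  shows "openin (prod_topology (D_topology P) (D_topology P)) Q"
proof (rule euclidean_atlas_prod_openin[OF atlas atlas])
  show "Q \<subseteq> topspace (D_topology P) \<times> topspace (D_topology P)"
    using Q topspace_D by simp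
  fix js ks assume js: "js \<in> lists I" and ks: "ks \<in> lists I"
  note dom = plot_domain[OF retract_chart_plot[OF js]] plot_domain[OF retract_chart_plot[OF ks]]
  show "openin (prod_topology (Euclidean_space (chart_dim d js)) (Euclidean_space (chart_dim d ks)))
      {(x, y) \<in> chart_dom d U js \<times> chart_dom d U ks. ((r \<circ> chart d js) x, (r \<circ> chart d ks) y) \<in> Q}"
    using plots dom plot_comp[OF retract_chart_plot[OF js] smooth_map_left_part[OF dom]]
      plot_comp[OF retract_chart_plot[OF ks] smooth_map_right_part[OF dom]]
    by (rule prod_plot_preimage)
qed

lemma openin_real_times:
  assumes Q: "Q \<subseteq> UNIV \<times> pts P"
    and plots: "\<And>n \<Omega> p. p \<in> plots (prod_dspace real_dspace P) n \<Omega> \<Longrightarrow>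
      openin (Euclidean_space n) {u \<in> \<Omega>. p u \<in> Q}"
  shows "openin (prod_topology euclideanreal (D_topology P)) Q"
proof (rule euclidean_atlas_prod_openin[OF euclidean_atlas_real atlas])
  show "Q \<subseteq> topspace euclideanreal \<times> topspace (D_topology P)"
    using Q topspace_D by simp
  fix a :: unit and js assume js: "js \<in> lists I"
  let ?L = "topspace (Euclidean_space 1)"
  have dom: "openin (Euclidean_space 1) ?L" "openin (Euclidean_space (chart_dim d js)) (chart_dom d U js)"
    using plot_domain[OF retract_chart_plot[OF js]] by auto
  have "(\<lambda>x. x 0) \<circ> left_part 1 \<in> plots real_dspace (1 + chart_dim d js)
      (product_dom 1 ?L (chart_dim d js) (chart_dom d U js))"
    using smooth_fun_coordinate[OF openin_product_dom[OF dom], of 0]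
    by (simp add: real_dspace_def left_part_def comp_def)
  with plots dom show "openin (prod_topology (Euclidean_space 1) (Euclidean_space (chart_dim d js)))
      {(x, y) \<in> ?L \<times> chart_dom d U js. (x 0, (r \<circ> chart d js) y) \<in> Q}"
    using plot_comp[OF retract_chart_plot[OF js] smooth_map_right_part[OF dom]]
    by (rule prod_plot_preimage)
qed

text \<open>\<open>openin_square\<close> is the substantial inclusion. The other one is formal:
  plots of the product are continuous into the product topology, and the D-topology is the finest
  with this property.\<close>

lemma D_topology_square:
  "D_topology (prod_dspace P P) = prod_topology (D_topology P) (D_topology P)"
proof -
  have PP: "diffeological_space (prod_dspace P P)"
    using diffeological_space_axioms by (intro diffeological_space_prod)
  have "openin (prod_topology (D_topology P) (D_topology P)) Q"
    if "openin (D_topology (prod_dspace P P)) Q" for Q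
    using that unfolding openin_D_topology[OF PP]
    by (intro openin_square) (auto simp: prod_dspace_def)
  moreover have "openin (D_topology (prod_dspace P P)) Q"
    if Q: "openin (prod_topology (D_topology P) (D_topology P)) Q" for Q
  proof (rule D_topology_finest[OF PP _ _ Q])
    show "topspace (prod_topology (D_topology P) (D_topology P)) = pts (prod_dspace P P)"
      using topspace_D by (simp add: prod_dspace_def)
    fix n \<Omega> p assume "p \<in> plots (prod_dspace P P) n \<Omega>"
    then have "fst \<circ> p \<in> plots P n \<Omega>" "snd \<circ> p \<in> plots P n \<Omega>"
      by (auto simp: prod_dspace_def)
    then show "continuous_map (subtopology (Euclidean_space n) \<Omega>)
        (prod_topology (D_topology P) (D_topology P)) p"
      using continuous_map_D_topology_plot[OF diffeological_space_axioms]
      by (simp add: continuous_map_pairwise)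
  qed
  ultimately show ?thesis
    unfolding topology_eq by blast
qed

lemma topological_vector_space: "topological_vector_space_on (D_topology P)"
  unfolding topological_vector_space_on_def
proof (intro conjI)
  \<comment> \<open>Shared by both operations: a smooth map into \<open>P\<close>, composed with a
    plot, is a plot of \<open>P\<close>, so D-open sets have open preimages.\<close>
  have pre: "openin (Euclidean_space n) {u \<in> \<Omega>. f (p u) \<in> A}"
    if "dsmooth X P f" "openin (D_topology P) A" "p \<in> plots X n \<Omega>" for f A p n \<Omega> and X :: "'b dspace"
  proof -
    have "f \<circ> p \<in> plots P n \<Omega>"
      using that unfolding dsmooth_def by blast
    then have "openin (Euclidean_space n) {u \<in> \<Omega>. (f \<circ> p) u \<in> A}"
      using that(2) openin_D_topology[OF diffeological_space_axioms] by blast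
    then show ?thesis by simp
  qed
  show "subspace (topspace (D_topology P))"
    using pts_subspace topspace_D by simp
  show "continuous_map (prod_topology (D_topology P) (D_topology P)) (D_topology P) (\<lambda>(x, y). x + y)"
    unfolding continuous_map
  proof (intro conjI allI impI)
    show "(\<lambda>(x, y). x + y) ` topspace (prod_topology (D_topology P) (D_topology P))
        \<subseteq> topspace (D_topology P)"
      using pts_subspace by (auto simp: topspace_D intro: subspace_add)
    fix A assume A: "openin (D_topology P) A"
    show "openin (prod_topology (D_topology P) (D_topology P))
        {z \<in> topspace (prod_topology (D_topology P) (D_topology P)). (\<lambda>(x, y). x + y) z \<in> A}"
    proof (rule openin_square)
      fix n \<Omega> p assume p: "p \<in> plots (prod_dspace P P) n \<Omega>"
      have "p ` \<Omega> \<subseteq> pts (prod_dspace P P)"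
        using p diffeological_space.plot_image[OF diffeological_space_prod]
          diffeological_space_axioms by blast
      then have "{u \<in> \<Omega>. p u \<in> {z \<in> topspace (prod_topology (D_topology P) (D_topology P)).
          (\<lambda>(x, y). x + y) z \<in> A}} = {u \<in> \<Omega>. (\<lambda>(x, y). x + y) (p u) \<in> A}"
        by (auto simp: topspace_D prod_dspace_def)
      then show "openin (Euclidean_space n) {u \<in> \<Omega>. p u \<in>
          {z \<in> topspace (prod_topology (D_topology P) (D_topology P)). (\<lambda>(x, y). x + y) z \<in> A}}"
        using pre[OF add_smooth A p] by simp
    qed (auto simp: topspace_D)
  qed
  show "continuous_map (prod_topology euclideanreal (D_topology P)) (D_topology P) (\<lambda>(c, x). c *\<^sub>R x)"
    unfolding continuous_map
  proof (intro conjI allI impI)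
    show "(\<lambda>(c, x). c *\<^sub>R x) ` topspace (prod_topology euclideanreal (D_topology P))
        \<subseteq> topspace (D_topology P)"
      using pts_subspace by (auto simp: topspace_D intro: subspace_scale)
    fix A assume A: "openin (D_topology P) A"
    show "openin (prod_topology euclideanreal (D_topology P))
        {z \<in> topspace (prod_topology euclideanreal (D_topology P)). (\<lambda>(c, x). c *\<^sub>R x) z \<in> A}"
    proof (rule openin_real_times)
      fix n \<Omega> p assume p: "p \<in> plots (prod_dspace real_dspace P) n \<Omega>"
      then have "(snd \<circ> p) ` \<Omega> \<subseteq> pts P"
        using plot_image[of "snd \<circ> p" n] by (simp add: prod_dspace_def)
      then have "{u \<in> \<Omega>. p u \<in> {z \<in> topspace (prod_topology euclideanreal (D_topology P)).
          (\<lambda>(c, x). c *\<^sub>R x) z \<in> A}} = {u \<in> \<Omega>. (\<lambda>(c, x). c *\<^sub>R x) (p u) \<in> A}"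
        by (auto simp: topspace_D image_subset_iff mem_Times_iff)
      then show "openin (Euclidean_space n) {u \<in> \<Omega>. p u \<in>
          {z \<in> topspace (prod_topology euclideanreal (D_topology P)). (\<lambda>(c, x). c *\<^sub>R x) z \<in> A}}"
        using pre[OF scaleR_smooth A p] by simp
    qed (auto simp: topspace_D)
  qed
qed

end

theorem theorem8p7:
  fixes P :: "'a::real_vector dspace"
  assumes "countably_generated_projective TYPE('v::real_vector) TYPE('w::real_vector) P"
  shows "k_omega_space (D_topology P) \<and> normal_space (D_topology P) \<and>
    topological_vector_space_on (D_topology P) \<and>
    D_topology (prod_dspace P P) = prod_topology (D_topology P) (D_topology P)"
proof -
  obtain I :: "nat set" and d U s r where P: "diffeological_vector_space P"
    and U: "\<forall>i\<in>I. openin (Euclidean_space (d i)) (U i)"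
    and s: "smooth_linear P (sum_of_free I d U) s" and r: "smooth_linear (sum_of_free I d U) P r"
    and rs: "\<forall>x\<in>pts P. r (s x) = x"
    using assms unfolding countably_generated_projective_def projective_dvs_def
      smooth_direct_summand_def by blast
  interpret retract_of_sum_of_free P I d U s r
    using P U s r rs unfolding smooth_linear_def
    by (intro retract_of_sum_of_free.intro retract_of_sum_of_free_axioms.intro) auto
  obtain K where "k_omega_exhaustion (D_topology P) K"
    using euclidean_atlas.exhaustion[OF atlas] by blast
  then show ?thesis
    using k_omega_exhaustion.k_omega_space k_omega_exhaustion_normal topological_vector_space
      D_topology_square by blast
qed

end
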